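(* The following identity of polynomials in $T$ holds: $$C_\rho(T+R_1)=(\mathcal E-T)\,C_n(T+1).$$ In particular, $C_\rho(\mathcal E+R_1)=0$.
   Context: The base field is $\mathbb C$ and $n$ is a fixed positive integer. $E_{ij}$ are the elementary matrices; indices run over $1,\dots,n$ for $\mathfrak{gl}(n)$ and over $0,\dots,n$ for $\mathfrak{gl}(n+1)$. In tensor products, $a_1$ and $a_2$ are written for $a_1\otimes1$ and $1\otimes a_2$. $\mathcal D'(n)$ is the subalgebra of the algebra of differential operators on $\mathbb C[t_0^{\pm1},t_1,\dots,t_n]$ generated by $\frac{t_i}{t_0}$ ($1\le i\le n$) and $t_0\partial_j$ ($0\le j\le n$), where $\partial_j=\partial/\partial t_j$; $\mathcal E=\sum_{i=0}^n t_i\partial_i$. Put $G_1^{\mathfrak{gl}(n)}=\sum_{i=1}^nE_{ii}$ and $R_1=-\frac1{n+1}\left(\mathcal E\otimes1+1\otimes G_1^{\mathfrak{gl}(n)}\right)$, a central element of $\mathcal D'(n)\otimes U(\mathfrak{gl}(n))$. The map $\rho:U(\mathfrak{gl}(n+1))\to\mathcal D'(n)\otimes U(\mathfrak{gl}(n))$ is the homomorphism of associative unital algebras determined by $E_{ab}\mapsto t_a\partial_b\otimes1+1\otimes E_{ab}+\delta_{ab}R_1$ for $a,b>0$; $E_{a0}\mapsto t_a\partial_0\otimes1-\sum_{i>0}\frac{t_i}{t_0}\otimes E_{ai}$ for $a>0$; $E_{0b}\mapsto t_0\partial_b\otimes1$ for $b>0$; $E_{00}\mapsto t_0\partial_0\otimes1+R_1$.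 Determinants are column determinants: for an $N\times N$ matrix $A$ over an associative algebra with rows and columns indexed $1,\dots,N$, $\det(A)=\sum_{\sigma\in S_N}\operatorname{sgn}(\sigma)A_{\sigma(1)1}A_{\sigma(2)2}\cdots A_{\sigma(N)N}$ (analogously for index set $0,\dots,n$). $T$ is a formal variable commuting with all $E_{ij}$. The Capelli determinant $C_n(T)\in U(\mathfrak{gl}(n))[T]$ is the determinant of the $n\times n$ matrix with $(i,j)$ entry $E_{ij}-\delta_{ij}(T+i-1)$, $1\le i,j\le n$. The Capelli determinant $C_{n+1}(T)\in U(\mathfrak{gl}(n+1))[T]$ is the determinant of the $(n+1)\times(n+1)$ matrix with $(i,j)$ entry $E_{ij}-\delta_{ij}(T+i)$, $0\le i,j\le n$. Their coefficients are central in $U(\mathfrak{gl}(n))$, respectively $U(\mathfrak{gl}(n+1))$. $C_\rho(T)$ is the polynomial in $T$ over $\mathcal D'(n)\otimes U(\mathfrak{gl}(n))$ obtained from $C_{n+1}(T)$ by applying $\rho$ to its coefficients (with $\rho(T)$ identified with $T$). *)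

theory Defs
  imports
    Complex_Main
    "HOL-Library.Poly_Mapping"
    "HOL-Library.Product_Plus"
    "HOL-Library.Option_ord"
    "HOL-Combinatorics.Permutations"
begin

section \<open>Associative unital algebras over the complex numbers\<close>

class calgebra_1 = ring_1 +
  fixes scaleC :: "complex \<Rightarrow> 'a \<Rightarrow> 'a"  (infixr \<open>*\<^sub>C\<close> 75)
  assumes scaleC_add_right: "c *\<^sub>C (x + y) = c *\<^sub>C x + c *\<^sub>C y"
    and scaleC_add_left: "(c + d) *\<^sub>C x = c *\<^sub>C x + d *\<^sub>C x"
    and scaleC_scaleC: "c *\<^sub>C d *\<^sub>C x = (c * d) *\<^sub>C x"
    and scaleC_one: "1 *\<^sub>C x = x"
    and mult_scaleC_left: "c *\<^sub>C x * y = c *\<^sub>C (x * y)"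
    and mult_scaleC_right: "x * c *\<^sub>C y = c *\<^sub>C (x * y)"

lemma scaleC_zero_left [simp]: "0 *\<^sub>C x = (0 :: 'a::calgebra_1)"
  by (metis add_cancel_right_left scaleC_add_left)

lemma scaleC_zero_right [simp]: "c *\<^sub>C 0 = (0 :: 'a::calgebra_1)"
  by (metis add_cancel_right_left scaleC_add_right)

lemma scaleC_minus_right: "c *\<^sub>C (- x) = - (c *\<^sub>C (x :: 'a::calgebra_1))"
  by (metis add.right_inverse neg_eq_iff_add_eq_0 scaleC_add_right scaleC_zero_right)

lemma scaleC_diff_right: "c *\<^sub>C (x - y) = c *\<^sub>C x - c *\<^sub>C (y :: 'a::calgebra_1)"
  by (metis diff_conv_add_uminus scaleC_add_right scaleC_minus_right)

lemma scaleC_sum_right: "c *\<^sub>C sum f S = (\<Sum>s\<in>S. c *\<^sub>C (f s :: 'a::calgebra_1))"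
  by (induction S rule: infinite_finite_induct) (auto simp: scaleC_add_right)

lemma vector_space_scaleC: "vector_space (scaleC :: complex \<Rightarrow> 'a::calgebra_1 \<Rightarrow> 'a)"
  by unfold_locales (auto simp: scaleC_add_right scaleC_add_left scaleC_scaleC scaleC_one)

instantiation complex :: calgebra_1
begin
definition "scaleC = ((*) :: complex \<Rightarrow> complex \<Rightarrow> complex)"
instance by standard (auto simp: scaleC_complex_def algebra_simps)
end

text \<open>For a monoid \<open>'m\<close> (written additively) the type \<open>'m \<Rightarrow>\<^sub>0 'a\<close> carries the
  convolution product, i.e. it is the monoid algebra of \<open>'m\<close> over \<open>'a\<close>.\<close>

lemma poly_mapping_expand: "p = (\<Sum>k\<in>Poly_Mapping.keys p. Poly_Mapping.single k (Poly_Mapping.lookup p k))"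
proof (rule poly_mapping_eqI)
  fix k
  have "Poly_Mapping.lookup (\<Sum>k\<in>Poly_Mapping.keys p. Poly_Mapping.single k (Poly_Mapping.lookup p k)) k
      = (\<Sum>l\<in>Poly_Mapping.keys p. if l = k then Poly_Mapping.lookup p l else 0)"
    by (simp add: lookup_sum lookup_single when_def)
  also have "\<dots> = Poly_Mapping.lookup p k"
    by (simp add: in_keys_iff)
  finally show "Poly_Mapping.lookup p k = Poly_Mapping.lookup (\<Sum>k\<in>Poly_Mapping.keys p. Poly_Mapping.single k (Poly_Mapping.lookup p k)) k" ..
qed

lemma poly_mapping_single_induct [case_names add single]:
  assumes "\<And>p q. P p \<Longrightarrow> P q \<Longrightarrow> P (p + q)"
    and "\<And>k c. P (Poly_Mapping.single k c)"
  shows "P (p :: 'a \<Rightarrow>\<^sub>0 'b::comm_monoid_add)"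
proof -
  have "P 0" using assms(2)[of _ 0] by simp
  then have "P (\<Sum>k\<in>S. Poly_Mapping.single k (Poly_Mapping.lookup p k))" for S
    by (induction S rule: infinite_finite_induct) (auto intro: assms)
  then show ?thesis by (metis poly_mapping_expand)
qed

lemma map_scaleC_eq:
  "Poly_Mapping.map (scaleC c) p = Poly_Mapping.single 0 (c *\<^sub>C 1) * (p :: 'm::monoid_add \<Rightarrow>\<^sub>0 'a::calgebra_1)"
proof -
  have "scaleC c = ((*) (c *\<^sub>C (1::'a)))"
    by (rule ext) (simp add: mult_scaleC_left)
  then show ?thesis
    by (metis mult_map_scale_conv_mult)
qed

lemma lookup_map_scaleC:
  "Poly_Mapping.lookup (Poly_Mapping.map (scaleC c) p) k = c *\<^sub>C (Poly_Mapping.lookup p k :: 'a::calgebra_1)"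
  by (simp add: map.rep_eq when_def)

lemma single_zero_mult_commute:
  assumes "\<And>y. z * y = y * (z :: 'a::ring_1)"
  shows "Poly_Mapping.single 0 z * p = (p :: 'm::monoid_add \<Rightarrow>\<^sub>0 'a) * Poly_Mapping.single 0 z"
  by (induction p rule: poly_mapping_single_induct)
    (auto simp: distrib_left distrib_right mult_single assms)

instantiation poly_mapping :: (monoid_add, calgebra_1) calgebra_1
begin
definition "scaleC c (p :: 'a \<Rightarrow>\<^sub>0 'b) = Poly_Mapping.map (scaleC c) p"
instance
proof
  fix c d :: complex and x y :: "'a \<Rightarrow>\<^sub>0 'b"
  show "c *\<^sub>C (x + y) = c *\<^sub>C x + c *\<^sub>C y"
    by (rule poly_mapping_eqI) (simp add: scaleC_poly_mapping_def lookup_map_scaleC lookup_add scaleC_add_right)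
  show "(c + d) *\<^sub>C x = c *\<^sub>C x + d *\<^sub>C x"
    by (rule poly_mapping_eqI) (simp add: scaleC_poly_mapping_def lookup_map_scaleC lookup_add scaleC_add_left)
  show "c *\<^sub>C d *\<^sub>C x = (c * d) *\<^sub>C x"
    by (rule poly_mapping_eqI) (simp add: scaleC_poly_mapping_def lookup_map_scaleC scaleC_scaleC)
  show "1 *\<^sub>C x = x"
    by (rule poly_mapping_eqI) (simp add: scaleC_poly_mapping_def lookup_map_scaleC scaleC_one)
  show "c *\<^sub>C x * y = c *\<^sub>C (x * y)"
    by (simp add: scaleC_poly_mapping_def map_scaleC_eq mult.assoc)
  have "Poly_Mapping.single 0 (c *\<^sub>C 1) * x = x * Poly_Mapping.single 0 (c *\<^sub>C 1)"
    by (rule single_zero_mult_commute) (simp add: mult_scaleC_left mult_scaleC_right)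
  then show "x * c *\<^sub>C y = c *\<^sub>C (x * y)"
    by (simp add: scaleC_poly_mapping_def map_scaleC_eq flip: mult.assoc)
qed
end

lemma lookup_scaleC [simp]: "Poly_Mapping.lookup (c *\<^sub>C p) k = c *\<^sub>C Poly_Mapping.lookup p k"
  by (simp add: scaleC_poly_mapping_def lookup_map_scaleC)

lemma scaleC_single: "c *\<^sub>C Poly_Mapping.single k x = Poly_Mapping.single k (c *\<^sub>C x)"
  by (rule poly_mapping_eqI) (simp add: lookup_single when_def)

section \<open>Linear and multiplicative extensions to monoid algebras\<close>

definition linext :: "('m \<Rightarrow> 'a::calgebra_1) \<Rightarrow> ('m \<Rightarrow>\<^sub>0 complex) \<Rightarrow> 'a" where
  "linext h p = (\<Sum>m\<in>Poly_Mapping.keys p. Poly_Mapping.lookup p m *\<^sub>C h m)"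

lemma linext_superset:
  assumes "finite S" "Poly_Mapping.keys p \<subseteq> S"
  shows "linext h p = (\<Sum>m\<in>S. Poly_Mapping.lookup p m *\<^sub>C h m)"
  unfolding linext_def using assms by (intro sum.mono_neutral_left) (auto simp: in_keys_iff)

lemma linext_single [simp]: "linext h (Poly_Mapping.single m c) = c *\<^sub>C h m"
  by (simp add: linext_def)

lemma linext_zero [simp]: "linext h 0 = 0"
  by (simp add: linext_def)

lemma linext_add: "linext h (p + q) = linext h p + linext h q"
proof -
  have "Poly_Mapping.keys (p + q) \<subseteq> Poly_Mapping.keys p \<union> Poly_Mapping.keys q" by (rule keys_add)
  then show ?thesis
    by (simp add: linext_superset[of "Poly_Mapping.keys p \<union> Poly_Mapping.keys q"] lookup_add scaleC_add_left sum.distrib)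
qed

lemma linext_minus: "linext h (- p) = - linext h p"
  by (metis add.right_inverse linext_add linext_zero minus_unique)

lemma linext_diff: "linext h (p - q) = linext h p - linext h q"
  by (metis diff_conv_add_uminus linext_add linext_minus)

lemma linext_scaleC: "linext h (c *\<^sub>C p) = c *\<^sub>C linext h p"
  by (induction p rule: poly_mapping_single_induct)
    (auto simp: linext_add scaleC_add_right scaleC_single scaleC_scaleC scaleC_complex_def)

lemma linext_mult:
  assumes "\<And>u v. h (u + v) = h u * h (v :: 'm::monoid_add)"
  shows "linext h (p * q) = linext h p * linext h q"
proof (induction p rule: poly_mapping_single_induct)
  case (single k c)
  show ?case
    by (induction q rule: poly_mapping_single_induct)
      (auto simp: linext_add distrib_left mult_single assms mult_scaleC_left mult_scaleC_right scaleC_scaleC mult.commute)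
qed (simp add: linext_add distrib_right)

section \<open>Two-sided ideals and quotients\<close>

inductive_set tsideal :: "'a::ring_1 set \<Rightarrow> 'a set" for R where
  zero: "0 \<in> tsideal R"
| base: "r \<in> R \<Longrightarrow> r \<in> tsideal R"
| add: "x \<in> tsideal R \<Longrightarrow> y \<in> tsideal R \<Longrightarrow> x + y \<in> tsideal R"
| mult_left: "x \<in> tsideal R \<Longrightarrow> a * x \<in> tsideal R"
| mult_right: "x \<in> tsideal R \<Longrightarrow> x * a \<in> tsideal R"

lemma tsideal_minus: "x \<in> tsideal R \<Longrightarrow> - x \<in> tsideal R"
  using tsideal.mult_left[of x R "-1"] by simp

lemma tsideal_cong_add:
  assumes "x - x' \<in> tsideal R" "y - y' \<in> tsideal R"
  shows "(x + y) - (x' + y') \<in> tsideal R"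
  using tsideal.add[OF assms] by (simp add: algebra_simps)

lemma tsideal_cong_minus:
  assumes "x - x' \<in> tsideal R"
  shows "(- x) - (- x') \<in> tsideal R"
  using tsideal_minus[OF assms] by simp

lemma tsideal_cong_diff:
  assumes "x - x' \<in> tsideal R" "y - y' \<in> tsideal R"
  shows "(x - y) - (x' - y') \<in> tsideal R"
  using tsideal.add[OF assms(1) tsideal_minus[OF assms(2)]] by (simp add: algebra_simps)

lemma tsideal_equivp: "equivp (\<lambda>x y. x - y \<in> tsideal R)"
proof (rule equivpI)
  show "reflp (\<lambda>x y. x - y \<in> tsideal R)"
    by (simp add: reflp_def tsideal.zero)
  show "symp (\<lambda>x y. x - y \<in> tsideal R)"
  proof (rule sympI)
    fix x y assume "x - y \<in> tsideal R"
    from tsideal_minus[OF this] show "y - x \<in> tsideal R" by simp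
  qed
  show "transp (\<lambda>x y. x - y \<in> tsideal R)"
  proof (rule transpI)
    fix x y z assume "x - y \<in> tsideal R" "y - z \<in> tsideal R"
    from tsideal.add[OF this] show "x - z \<in> tsideal R" by simp
  qed
qed

lemma tsideal_cong_mult:
  assumes "x - x' \<in> tsideal R" "y - y' \<in> tsideal R"
  shows "x * y - x' * y' \<in> tsideal R"
proof -
  have "x * y - x' * y' = (x - x') * y + x' * (y - y')"
    by (simp add: algebra_simps)
  then show ?thesis using assms by (auto intro: tsideal.intros)
qed

lemma tsideal_scaleC: "x \<in> tsideal R \<Longrightarrow> c *\<^sub>C x \<in> tsideal (R :: 'a::calgebra_1 set)"
  using tsideal.mult_left[of x R "c *\<^sub>C 1"] by (simp add: mult_scaleC_left)

lemma tsideal_cong_scaleC: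
  "x - y \<in> tsideal R \<Longrightarrow> c *\<^sub>C x - c *\<^sub>C y \<in> tsideal (R :: 'a::calgebra_1 set)"
  by (metis scaleC_diff_right tsideal_scaleC)

section \<open>The universal enveloping algebra of \<open>gl\<close>\<close>

text \<open>Words form the free monoid, so \<open>'g word \<Rightarrow>\<^sub>0 complex\<close> is the free associative
  algebra on \<open>'g\<close>.\<close>

datatype 'g word = Word "'g list"

instantiation word :: (type) monoid_add
begin
definition "0 = Word []"
fun plus_word where "Word u + Word v = Word (u @ v)"
instance
proof
  fix a b c :: "'a word"
  show "a + b + c = a + (b + c)" by (cases a; cases b; cases c) simp
  show "0 + a = a" "a + 0 = a" by (cases a; simp add: zero_word_def)+
qed
end

definition freegen :: "'g \<Rightarrow> 'g word \<Rightarrow>\<^sub>0 complex" where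
  "freegen g = Poly_Mapping.single (Word [g]) 1"

primrec word_prod :: "('g \<Rightarrow> 'a::monoid_mult) \<Rightarrow> 'g word \<Rightarrow> 'a" where
  "word_prod f (Word w) = prod_list (map f w)"

lemma word_prod_add: "word_prod f (u + v) = word_prod f u * word_prod f v"
  by (cases u; cases v) simp

lemma word_prod_zero [simp]: "word_prod f 0 = 1"
  by (simp add: zero_word_def)

abbreviation free_lift :: "('g \<Rightarrow> 'a::calgebra_1) \<Rightarrow> ('g word \<Rightarrow>\<^sub>0 complex) \<Rightarrow> 'a" where
  "free_lift f \<equiv> linext (word_prod f)"

lemma free_lift_mult: "free_lift f (p * q) = free_lift f p * free_lift f q"
  by (rule linext_mult) (rule word_prod_add)

lemma free_lift_one [simp]: "free_lift f 1 = 1"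
  by (simp add: scaleC_one flip: single_one)

lemma free_lift_gen [simp]: "free_lift f (freegen g) = f g"
  by (simp add: freegen_def scaleC_one)

text \<open>The relations $[E_{ij}, E_{kl}] = \delta_{jk} E_{il} - \delta_{li} E_{kj}$ of
  $\mathfrak{gl}$, with rows and columns indexed by the type \<open>'i\<close>.\<close>

definition gl_relations :: "(('i \<times> 'i) word \<Rightarrow>\<^sub>0 complex) set" where
  "gl_relations = {freegen (i, j) * freegen (k, l) - freegen (k, l) * freegen (i, j)
      - ((if j = k then freegen (i, l) else 0) - (if l = i then freegen (k, j) else 0)) | i j k l. True}"

definition ugl_rel ::
  "(('i \<times> 'i) word \<Rightarrow>\<^sub>0 complex) \<Rightarrow> (('i \<times> 'i) word \<Rightarrow>\<^sub>0 complex) \<Rightarrow> bool" where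
  "ugl_rel x y \<longleftrightarrow> x - y \<in> tsideal gl_relations"

quotient_type 'i ugl = "('i \<times> 'i) word \<Rightarrow>\<^sub>0 complex" / ugl_rel
  unfolding ugl_rel_def by (rule tsideal_equivp)

lemma free_lift_tsideal:
  assumes "\<And>r. r \<in> R \<Longrightarrow> free_lift f r = 0" "x \<in> tsideal R"
  shows "free_lift f x = 0"
  using assms(2) by induction (auto simp: assms(1) linext_add free_lift_mult)

lemma free_lift_gl_relations:
  assumes "\<And>i j k l. f i j * f k l - f k l * f i j
      = (if j = k then f i l else 0) - (if l = i then f k j else 0)"
    and "r \<in> gl_relations"
  shows "free_lift (case_prod f) r = 0"
proof -
  from assms(2) obtain i j k l where r:
    "r = freegen (i, j) * freegen (k, l) - freegen (k, l) * freegen (i, j)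
      - ((if j = k then freegen (i, l) else 0) - (if l = i then freegen (k, j) else 0))"
    unfolding gl_relations_def by blast
  have "free_lift (case_prod f) r = f i j * f k l - f k l * f i j
      - ((if j = k then f i l else 0) - (if l = i then f k j else 0))"
    unfolding r by (simp add: linext_diff free_lift_mult)
  then show ?thesis using assms(1) by simp
qed

instantiation ugl :: (type) calgebra_1
begin
lift_definition zero_ugl :: "'a ugl" is 0 .
lift_definition one_ugl :: "'a ugl" is 1 .
lift_definition plus_ugl :: "'a ugl \<Rightarrow> 'a ugl \<Rightarrow> 'a ugl" is "(+)"
  unfolding ugl_rel_def by (rule tsideal_cong_add)
lift_definition minus_ugl :: "'a ugl \<Rightarrow> 'a ugl \<Rightarrow> 'a ugl" is "(-)"
  unfolding ugl_rel_def by (rule tsideal_cong_diff)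
lift_definition uminus_ugl :: "'a ugl \<Rightarrow> 'a ugl" is uminus
  unfolding ugl_rel_def by (rule tsideal_cong_minus)
lift_definition times_ugl :: "'a ugl \<Rightarrow> 'a ugl \<Rightarrow> 'a ugl" is "(*)"
  unfolding ugl_rel_def by (rule tsideal_cong_mult)
lift_definition scaleC_ugl :: "complex \<Rightarrow> 'a ugl \<Rightarrow> 'a ugl" is scaleC
  unfolding ugl_rel_def by (rule tsideal_cong_scaleC)

instance
proof
  show "(0 :: 'a ugl) \<noteq> 1"
  proof
    assume "(0 :: 'a ugl) = 1"
    then have "0 - 1 \<in> tsideal (gl_relations :: (('a \<times> 'a) word \<Rightarrow>\<^sub>0 complex) set)"
      by (simp add: zero_ugl_def one_ugl_def ugl.abs_eq_iff ugl_rel_def)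
    then have "free_lift (case_prod (\<lambda>_ _. 0 :: complex)) (0 - 1 :: ('a \<times> 'a) word \<Rightarrow>\<^sub>0 complex) = 0"
      by (rule free_lift_tsideal[rotated]) (rule free_lift_gl_relations, auto)
    then show False by (simp add: linext_minus)
  qed
qed (transfer, simp add: ugl_rel_def tsideal.zero algebra_simps scaleC_add_right scaleC_add_left
      scaleC_scaleC scaleC_one mult_scaleC_left mult_scaleC_right)+
end

lift_definition Egl :: "'i \<Rightarrow> 'i \<Rightarrow> 'i ugl" is "\<lambda>i j. freegen (i, j)" .

lemma Egl_commutator:
  "Egl i j * Egl k l - Egl k l * Egl i j = (if j = k then Egl i l else 0) - (if l = i then Egl k j else 0)"
proof -
  define X where "X = (if j = k then freegen (i, l) else 0)"
  define Y where "Y = (if l = i then freegen (k, j) else 0)"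
  have "ugl_rel (freegen (i, j) * freegen (k, l) - freegen (k, l) * freegen (i, j)) (X - Y)"
    unfolding ugl_rel_def X_def Y_def by (rule tsideal.base) (auto simp: gl_relations_def)
  then have "abs_ugl (freegen (i, j) * freegen (k, l) - freegen (k, l) * freegen (i, j)) = abs_ugl (X - Y)"
    by (simp add: ugl.abs_eq_iff)
  moreover have "abs_ugl X = (if j = k then Egl i l else 0)" "abs_ugl Y = (if l = i then Egl k j else 0)"
    by (auto simp: X_def Y_def Egl.abs_eq zero_ugl_def)
  ultimately show ?thesis
    by (simp add: Egl.abs_eq flip: times_ugl.abs_eq minus_ugl.abs_eq)
qed

definition ugl_lift :: "('i \<Rightarrow> 'i \<Rightarrow> 'a::calgebra_1) \<Rightarrow> 'i ugl \<Rightarrow> 'a" where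
  "ugl_lift f u = free_lift (case_prod f) (rep_ugl u)"

lemma ugl_lift_hom:
  fixes f :: "'i \<Rightarrow> 'i \<Rightarrow> 'a::calgebra_1"
  assumes f: "\<And>i j k l. f i j * f k l - f k l * f i j
      = (if j = k then f i l else 0) - (if l = i then f k j else 0)"
  shows ugl_lift_add: "ugl_lift f (u + v) = ugl_lift f u + ugl_lift f v"
    and ugl_lift_mult: "ugl_lift f (u * v) = ugl_lift f u * ugl_lift f v"
    and ugl_lift_scaleC: "ugl_lift f (c *\<^sub>C u) = c *\<^sub>C ugl_lift f u"
    and ugl_lift_one: "ugl_lift f 1 = 1"
    and ugl_lift_Egl: "ugl_lift f (Egl i j) = f i j"
proof -
  have abs: "ugl_lift f (abs_ugl x) = free_lift (case_prod f) x" for x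
  proof -
    have "rep_ugl (abs_ugl x) - x \<in> tsideal gl_relations"
      using Quotient3_rep_abs[OF Quotient3_ugl] by (metis Quotient3_ugl equivp_reflp rep_abs_rsp_left ugl_equivp ugl_rel_def)
    then have "free_lift (case_prod f) (rep_ugl (abs_ugl x) - x) = 0"
      by (rule free_lift_tsideal[rotated]) (rule free_lift_gl_relations[OF f])
    then show ?thesis by (simp add: ugl_lift_def linext_diff)
  qed
  obtain x y where xy: "u = abs_ugl x" "v = abs_ugl y"
    by (metis Quotient3_abs_rep[OF Quotient3_ugl])
  show "ugl_lift f (u + v) = ugl_lift f u + ugl_lift f v"
    "ugl_lift f (u * v) = ugl_lift f u * ugl_lift f v"
    "ugl_lift f (c *\<^sub>C u) = c *\<^sub>C ugl_lift f u"
    "ugl_lift f 1 = 1" "ugl_lift f (Egl i j) = f i j"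
    by (simp_all add: xy plus_ugl.abs_eq times_ugl.abs_eq scaleC_ugl.abs_eq one_ugl_def Egl.abs_eq
        abs linext_add free_lift_mult linext_scaleC)
qed

section \<open>Tensor products of algebras\<close>

text \<open>\<open>Pure a b\<close> stands for the formal symbol \<open>a \<otimes> b\<close>; these symbols multiply componentwise,
  so that \<open>('a, 'b) pure \<Rightarrow>\<^sub>0 complex\<close> is the free vector space on \<open>'a \<times> 'b\<close> with the product
  \<open>(a \<otimes> b) (a' \<otimes> b') = a a' \<otimes> b b'\<close>.  A product of a pure symbol with a bilinearity
  relation is again a bilinearity relation of the same kind, so the two-sided ideal
  generated by these relations is just their span.\<close>

datatype ('a, 'b) pure = Pure 'a 'b

instantiation pure :: (monoid_mult, monoid_mult) monoid_add
begin
definition "0 = Pure 1 1"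
fun plus_pure where "Pure a b + Pure a' b' = Pure (a * a') (b * b')"
instance
proof
  fix a b c :: "('a, 'b) pure"
  show "a + b + c = a + (b + c)" by (cases a; cases b; cases c) (simp add: mult.assoc)
  show "0 + a = a" "a + 0 = a" by (cases a; simp add: zero_pure_def)+
qed
end

definition fpure :: "'a \<Rightarrow> 'b \<Rightarrow> ('a, 'b) pure \<Rightarrow>\<^sub>0 complex" where
  "fpure a b = Poly_Mapping.single (Pure a b) 1"

definition bilin_relations :: "(('a::calgebra_1, 'b::calgebra_1) pure \<Rightarrow>\<^sub>0 complex) set" where
  "bilin_relations =
     {fpure (a + a') b - (fpure a b + fpure a' b) | a a' b. True} \<union>
     {fpure a (b + b') - (fpure a b + fpure a b') | a b b'. True} \<union>
     {fpure (c *\<^sub>C a) b - c *\<^sub>C fpure a b | c a b. True} \<union>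
     {fpure a (c *\<^sub>C b) - c *\<^sub>C fpure a b | c a b. True}"

definition tensor_rel :: "(('a::calgebra_1, 'b::calgebra_1) pure \<Rightarrow>\<^sub>0 complex)
    \<Rightarrow> (('a, 'b) pure \<Rightarrow>\<^sub>0 complex) \<Rightarrow> bool" where
  "tensor_rel x y \<longleftrightarrow> x - y \<in> tsideal bilin_relations"

quotient_type (overloaded) ('a, 'b) tensor = "('a::calgebra_1, 'b::calgebra_1) pure \<Rightarrow>\<^sub>0 complex" / tensor_rel
  unfolding tensor_rel_def by (rule tsideal_equivp)

lemma fpure_mult: "fpure a b * fpure a' b' = fpure (a * a') (b * b')"
  by (simp add: fpure_def mult_single)

lemma fpure_one: "fpure 1 1 = 1"
  by (simp add: fpure_def zero_pure_def flip: single_one)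

lemma pure_algebra_induct [case_names fpure add scaleC]:
  assumes "\<And>a b. P (fpure a b)" "\<And>x y. P x \<Longrightarrow> P y \<Longrightarrow> P (x + y)" "\<And>c x. P x \<Longrightarrow> P (c *\<^sub>C x)"
  shows "P (x :: ('a::monoid_mult, 'b::monoid_mult) pure \<Rightarrow>\<^sub>0 complex)"
proof (induction x rule: poly_mapping_single_induct)
  case (single k c)
  obtain a b where k: "k = Pure a b" by (cases k)
  have "Poly_Mapping.single k c = c *\<^sub>C fpure a b"
    by (simp add: k fpure_def scaleC_single scaleC_complex_def)
  then show ?case using assms by simp
qed (rule assms)

text \<open>A functional witnessing that the tensor product of non-zero algebras is non-zero.\<close>

lemma unital_functional_exists:
  "\<exists>f :: 'a::calgebra_1 \<Rightarrow> complex. f 1 = 1 \<and> (\<forall>x y. f (x + y) = f x + f y) \<and> (\<forall>c x. f (c *\<^sub>C x) = c * f x)"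
proof -
  interpret A: vector_space "scaleC :: complex \<Rightarrow> 'a \<Rightarrow> 'a" by (rule vector_space_scaleC)
  interpret B: vector_space "(*) :: complex \<Rightarrow> complex \<Rightarrow> complex"
    by unfold_locales (auto simp: algebra_simps)
  interpret P: vector_space_pair "scaleC :: complex \<Rightarrow> 'a \<Rightarrow> 'a" "(*) :: complex \<Rightarrow> complex \<Rightarrow> complex" ..
  have "A.independent {1}" by simp
  from P.linear_independent_extend[OF this, of "\<lambda>_. 1"]
  obtain g where g: "Vector_Spaces.linear (scaleC :: complex \<Rightarrow> 'a \<Rightarrow> 'a) (*) g" "g 1 = 1" by auto
  interpret g: Vector_Spaces.linear "scaleC :: complex \<Rightarrow> 'a \<Rightarrow> 'a" "(*)" g by (rule g)
  show ?thesis using g(2) g.add g.scale by blast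
qed

lemma one_notin_bilin_ideal:
  "(1 :: ('a::calgebra_1, 'b::calgebra_1) pure \<Rightarrow>\<^sub>0 complex) \<notin> tsideal bilin_relations"
proof
  assume one: "(1 :: ('a, 'b) pure \<Rightarrow>\<^sub>0 complex) \<in> tsideal bilin_relations"
  obtain f :: "'a \<Rightarrow> complex" where f: "f 1 = 1" "\<And>x y. f (x + y) = f x + f y" "\<And>c x. f (c *\<^sub>C x) = c * f x"
    using unital_functional_exists by blast
  obtain g :: "'b \<Rightarrow> complex" where g: "g 1 = 1" "\<And>x y. g (x + y) = g x + g y" "\<And>c x. g (c *\<^sub>C x) = c * g x"
    using unital_functional_exists by blast
  define \<phi> where "\<phi> = linext (\<lambda>p. case p of Pure a b \<Rightarrow> f a * g b)"
  have \<phi>_fpure: "\<phi> (fpure a b) = f a * g b" for a b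
    by (simp add: \<phi>_def fpure_def scaleC_one)
  have lin: "\<phi> (x + y) = \<phi> x + \<phi> y" "\<phi> (x - y) = \<phi> x - \<phi> y" "\<phi> (c *\<^sub>C x) = c * \<phi> x" for x y c
    by (simp_all add: \<phi>_def linext_add linext_diff linext_scaleC scaleC_complex_def)
  have base: "\<phi> (fpure a b * r * fpure a' b') = 0" if "r \<in> bilin_relations" for r a b a' b'
    using that unfolding bilin_relations_def
    by (auto simp: left_diff_distrib right_diff_distrib distrib_left distrib_right fpure_mult \<phi>_fpure lin f g mult_scaleC_left mult_scaleC_right)
  have base: "\<phi> (x * r * y) = 0" if r: "r \<in> bilin_relations" for r x y
  proof (induction x rule: pure_algebra_induct)
    case (fpure a b)
    show ?case
      by (induction y rule: pure_algebra_induct) (auto simp: base r distrib_left lin mult_scaleC_right)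
  qed (auto simp: distrib_right lin mult_scaleC_left)
  have "\<forall>x y. \<phi> (x * z * y) = 0" if "z \<in> tsideal bilin_relations" for z
    using that
  proof induction
    case (mult_left z a)
    then show ?case by (metis mult.assoc)
  next
    case (mult_right z a)
    then show ?case by (metis mult.assoc)
  qed (auto simp: base[unfolded \<phi>_def] \<phi>_def distrib_left distrib_right linext_add)
  from this[OF one] have "\<phi> (1 * 1 * 1) = 0" by blast
  then show False by (simp add: fpure_mult \<phi>_fpure f g flip: fpure_one)
qed

instantiation tensor :: (calgebra_1, calgebra_1) calgebra_1
begin
lift_definition zero_tensor :: "('a, 'b) tensor" is 0 .
lift_definition one_tensor :: "('a, 'b) tensor" is 1 .
lift_definition plus_tensor :: "('a, 'b) tensor \<Rightarrow> ('a, 'b) tensor \<Rightarrow> ('a, 'b) tensor" is "(+)"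
  unfolding tensor_rel_def by (rule tsideal_cong_add)
lift_definition minus_tensor :: "('a, 'b) tensor \<Rightarrow> ('a, 'b) tensor \<Rightarrow> ('a, 'b) tensor" is "(-)"
  unfolding tensor_rel_def by (rule tsideal_cong_diff)
lift_definition uminus_tensor :: "('a, 'b) tensor \<Rightarrow> ('a, 'b) tensor" is uminus
  unfolding tensor_rel_def by (rule tsideal_cong_minus)
lift_definition times_tensor :: "('a, 'b) tensor \<Rightarrow> ('a, 'b) tensor \<Rightarrow> ('a, 'b) tensor" is "(*)"
  unfolding tensor_rel_def by (rule tsideal_cong_mult)
lift_definition scaleC_tensor :: "complex \<Rightarrow> ('a, 'b) tensor \<Rightarrow> ('a, 'b) tensor" is scaleC
  unfolding tensor_rel_def by (rule tsideal_cong_scaleC)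

instance
proof
  show "(0 :: ('a, 'b) tensor) \<noteq> 1"
  proof
    assume "(0 :: ('a, 'b) tensor) = 1"
    then have "0 - (1 :: ('a, 'b) pure \<Rightarrow>\<^sub>0 complex) \<in> tsideal bilin_relations"
      by (simp add: zero_tensor_def one_tensor_def tensor.abs_eq_iff tensor_rel_def)
    from tsideal_minus[OF this] show False by (simp add: one_notin_bilin_ideal)
  qed
qed (transfer, simp add: tensor_rel_def tsideal.zero algebra_simps scaleC_add_right scaleC_add_left
      scaleC_scaleC scaleC_one mult_scaleC_left mult_scaleC_right)+
end

lift_definition tens :: "'a::calgebra_1 \<Rightarrow> 'b::calgebra_1 \<Rightarrow> ('a, 'b) tensor" (infixr \<open>\<otimes>\<close> 76)
  is fpure .

lemma tens_add_left: "(a + a') \<otimes> b = a \<otimes> b + a' \<otimes> b"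
  by transfer (unfold tensor_rel_def bilin_relations_def, rule tsideal.base, blast)

lemma tens_add_right: "a \<otimes> (b + b') = a \<otimes> b + a \<otimes> b'"
  by transfer (unfold tensor_rel_def bilin_relations_def, rule tsideal.base, blast)

lemma tens_scaleC_left: "(c *\<^sub>C a) \<otimes> b = c *\<^sub>C (a \<otimes> b)"
  by transfer (unfold tensor_rel_def bilin_relations_def, rule tsideal.base, blast)

lemma tens_scaleC_right: "a \<otimes> (c *\<^sub>C b) = c *\<^sub>C (a \<otimes> b)"
  by transfer (unfold tensor_rel_def bilin_relations_def, rule tsideal.base, blast)

lemma tens_mult: "(a \<otimes> b) * (a' \<otimes> b') = (a * a') \<otimes> (b * b')"
  by transfer (simp add: fpure_mult tensor_rel_def tsideal.zero)

lemma tens_one: "1 \<otimes> 1 = 1"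
  by transfer (simp add: fpure_one tensor_rel_def tsideal.zero)

lemma tens_zero_left [simp]: "0 \<otimes> b = 0"
  by (metis add_cancel_right_left tens_add_left)

lemma tens_zero_right [simp]: "a \<otimes> 0 = 0"
  by (metis add_cancel_right_left tens_add_right)

lemma tens_minus_left: "(- a) \<otimes> b = - (a \<otimes> b)"
  by (metis add.right_inverse minus_unique tens_add_left tens_zero_left)

lemma tens_minus_right: "a \<otimes> (- b) = - (a \<otimes> b)"
  by (metis add.right_inverse minus_unique tens_add_right tens_zero_right)

lemma tens_diff_left: "(a - a') \<otimes> b = a \<otimes> b - a' \<otimes> b"
  by (metis diff_conv_add_uminus tens_add_left tens_minus_left)

lemma tens_diff_right: "a \<otimes> (b - b') = a \<otimes> b - a \<otimes> b'"
  by (metis diff_conv_add_uminus tens_add_right tens_minus_right)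

lemma tens_sum_left: "sum f S \<otimes> b = (\<Sum>s\<in>S. f s \<otimes> b)"
  by (induction S rule: infinite_finite_induct) (auto simp: tens_add_left)

lemma tens_sum_right: "a \<otimes> sum f S = (\<Sum>s\<in>S. a \<otimes> f s)"
  by (induction S rule: infinite_finite_induct) (auto simp: tens_add_right)

section \<open>The algebra of differential operators \<open>D'(n)\<close>\<close>

text \<open>With \<open>'n\<close> playing the role of the index set $\{1,\dots,n\}$, the index set
  $\{0,\dots,n\}$ is \<open>'n option\<close>, where \<open>None\<close> is the index \<open>0\<close>.  A monomial of
  $\mathbb C[t_0^{\pm1}, t_1, \dots, t_n]$ is a pair of an integer exponent of $t_0$ and the
  non-negative exponents of the $t_i$ with $i > 0$.\<close>

type_synonym 'n lpoly = "(int \<times> ('n \<Rightarrow>\<^sub>0 nat)) \<Rightarrow>\<^sub>0 complex"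

fun lvar :: "'n option \<Rightarrow> 'n lpoly" where
  "lvar None = Poly_Mapping.single (1, 0) 1"
| "lvar (Some i) = Poly_Mapping.single (0, Poly_Mapping.single i 1) 1"

definition lvar0_inv :: "'n lpoly" where
  "lvar0_inv = Poly_Mapping.single (-1, 0) 1"

declare lvar.simps [simp del]

lemma lvar0_inv: "lvar None * lvar0_inv = 1"
  by (simp add: lvar.simps lvar0_inv_def mult_single flip: single_one zero_prod_def)

lemma lvar0_inv_cancel: "lvar0_inv * (lvar None * q) = q" "lvar None * (lvar0_inv * q) = q"
    "lvar0_inv * (q * lvar None) = q"
proof -
  show *: "lvar None * (lvar0_inv * q) = q"
    by (simp add: lvar0_inv flip: mult.assoc)
  show "lvar0_inv * (lvar None * q) = q"
    by (subst mult.left_commute) (rule *)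
  then show "lvar0_inv * (q * lvar None) = q"
    by (simp add: mult.commute)
qed

fun mon_deriv :: "'n option \<Rightarrow> int \<times> ('n \<Rightarrow>\<^sub>0 nat) \<Rightarrow> 'n lpoly" where
  "mon_deriv None (k, m) = Poly_Mapping.single (k - 1, m) (of_int k)"
| "mon_deriv (Some i) (k, m) =
     Poly_Mapping.single (k, m - Poly_Mapping.single i 1) (of_nat (Poly_Mapping.lookup m i))"

definition lderiv :: "'n option \<Rightarrow> 'n lpoly \<Rightarrow> 'n lpoly" where
  "lderiv j = linext (mon_deriv j)"

lemma lderiv_add: "lderiv j (p + q) = lderiv j p + lderiv j q"
  by (simp add: lderiv_def linext_add)

lemma lderiv_scaleC: "lderiv j (c *\<^sub>C p) = c *\<^sub>C lderiv j p"
  by (simp add: lderiv_def linext_scaleC)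

lemma lpoly_induct [case_names mon add scaleC]:
  assumes "\<And>k m. P (Poly_Mapping.single (k, m) 1)" "\<And>x y. P x \<Longrightarrow> P y \<Longrightarrow> P (x + y)"
    and "\<And>c x. P x \<Longrightarrow> P (c *\<^sub>C x)"
  shows "P (x :: 'n lpoly)"
proof (induction x rule: poly_mapping_single_induct)
  case (single m c)
  have "Poly_Mapping.single m c = c *\<^sub>C Poly_Mapping.single m 1"
    by (simp add: scaleC_single scaleC_complex_def)
  then show ?case using assms by (cases m) simp
qed (rule assms)

lemma lderiv_mon [simp]: "lderiv j (Poly_Mapping.single m 1) = mon_deriv j m"
  by (simp add: lderiv_def scaleC_one)

lemma single_i_shift:
  fixes m m' :: "'n \<Rightarrow>\<^sub>0 nat"
  shows "Poly_Mapping.lookup m i \<noteq> 0 \<Longrightarrow>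
    m + m' - Poly_Mapping.single i 1 = m - Poly_Mapping.single i 1 + m'"
  by (rule poly_mapping_eqI) (auto simp: lookup_add lookup_minus lookup_single when_def)

lemma single_coeff_zero_cong:
  "(c \<noteq> 0 \<Longrightarrow> k = k') \<Longrightarrow> Poly_Mapping.single k c = Poly_Mapping.single k' (c :: 'a::zero)"
  by (cases "c = 0") auto

lemma lderiv_mult: "lderiv j (p * q) = lderiv j p * q + p * lderiv j q"
proof (induction p rule: lpoly_induct)
  case (mon k m)
  show ?case
  proof (induction q rule: lpoly_induct)
    case (mon k' m')
    show ?case
    proof (cases j)
      case None
      show ?thesis
        by (simp add: None mult_single algebra_simps flip: single_add)
    next
      case (Some i)
      have 1: "Poly_Mapping.single (k + k', m - Poly_Mapping.single i (1::nat) + m') (of_nat (Poly_Mapping.lookup m i))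
          = Poly_Mapping.single (k + k', m + m' - Poly_Mapping.single i 1) (of_nat (Poly_Mapping.lookup m i) :: complex)"
        by (rule single_coeff_zero_cong) (use single_i_shift[of m i m'] in simp)
      have 2: "Poly_Mapping.single (k + k', m + (m' - Poly_Mapping.single i (1::nat))) (of_nat (Poly_Mapping.lookup m' i))
          = Poly_Mapping.single (k + k', m + m' - Poly_Mapping.single i 1) (of_nat (Poly_Mapping.lookup m' i) :: complex)"
        by (rule single_coeff_zero_cong)
          (use single_i_shift[of m' i m] in \<open>simp add: add.commute\<close>)
      show ?thesis
        using 1 2 by (simp add: Some mult_single lookup_add single_add)
    qed
  qed (auto simp: lderiv_add lderiv_scaleC algebra_simps mult_scaleC_left mult_scaleC_right scaleC_add_right)
qed (auto simp: lderiv_add lderiv_scaleC algebra_simps mult_scaleC_left mult_scaleC_right scaleC_add_right)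

lemma lderiv_commute: "lderiv i (lderiv j p) = lderiv j (lderiv i p)"
proof (induction p rule: lpoly_induct)
  case (mon k m)
  have lin: "lderiv i (Poly_Mapping.single l c) = c *\<^sub>C mon_deriv i l" for i l and c :: complex
    by (simp add: lderiv_def)
  show ?case
  proof (cases "i = j")
    case False
    then show ?thesis
      by (cases i; cases j)
        (auto simp: lin scaleC_single scaleC_complex_def lookup_minus lookup_single when_def
          mult.commute diff_diff_add add.commute)
  qed simp
qed (auto simp: lderiv_add lderiv_scaleC)

lemma lderiv_lvar: "lderiv j (lvar i) = (if i = j then 1 else 0)"
  by (cases i; cases j) (auto simp: lvar.simps lookup_single when_def simp flip: single_one zero_prod_def)

lemma lderiv_lvar0_inv: "lderiv j lvar0_inv = (if j = None then - (lvar0_inv * lvar0_inv) else 0)"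
  by (cases j) (auto simp: lvar0_inv_def mult_single single_uminus)

text \<open>The subalgebra generated by the multiplications by $t_i/t_0$ and the operators
  $t_0\partial_j$ does not depend on which algebra of operators on
  $\mathbb C[t_0^{\pm1}, t_1, \dots, t_n]$ it is generated in.\<close>

inductive_set dops :: "('n lpoly \<Rightarrow> 'n lpoly) set" where
  dops_ratio: "(\<lambda>p. lvar (Some i) * lvar0_inv * p) \<in> dops"
| dops_t0_deriv: "(\<lambda>p. lvar None * lderiv j p) \<in> dops"
| dops_one: "(\<lambda>p. p) \<in> dops"
| dops_add: "f \<in> dops \<Longrightarrow> g \<in> dops \<Longrightarrow> (\<lambda>p. f p + g p) \<in> dops"
| dops_mult: "f \<in> dops \<Longrightarrow> g \<in> dops \<Longrightarrow> (\<lambda>p. f (g p)) \<in> dops"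
| dops_scaleC: "f \<in> dops \<Longrightarrow> (\<lambda>p. c *\<^sub>C f p) \<in> dops"

lemma dops_linear:
  assumes "f \<in> dops"
  shows dops_apply_add: "f (p + q) = f p + f q"
    and dops_apply_scaleC: "f (c *\<^sub>C p) = c *\<^sub>C f p"
proof -
  have "(\<forall>p q. f (p + q) = f p + f q) \<and> (\<forall>c p. f (c *\<^sub>C p) = c *\<^sub>C f p)"
    using assms
    by induction (auto simp: distrib_left lderiv_add lderiv_scaleC mult_scaleC_right
        scaleC_add_right scaleC_scaleC mult.commute[where 'a = complex] add_ac)
  then show "f (p + q) = f p + f q" "f (c *\<^sub>C p) = c *\<^sub>C f p" by auto
qed

typedef 'n dprime = "dops :: ('n lpoly \<Rightarrow> 'n lpoly) set"
  morphisms apply_op Abs_dprime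
  using dops_one by blast

setup_lifting type_definition_dprime

lemma dprime_eqI: "(\<And>p. apply_op f p = apply_op g p) \<Longrightarrow> f = g"
  by (metis apply_op_inject ext)

instantiation dprime :: (type) calgebra_1
begin
lift_definition zero_dprime :: "'a dprime" is "\<lambda>p. 0"
  using dops_scaleC[OF dops_one, of 0] by simp
lift_definition one_dprime :: "'a dprime" is "\<lambda>p. p" by (rule dops_one)
lift_definition plus_dprime :: "'a dprime \<Rightarrow> 'a dprime \<Rightarrow> 'a dprime" is "\<lambda>f g p. f p + g p"
  by (rule dops_add)
lift_definition uminus_dprime :: "'a dprime \<Rightarrow> 'a dprime" is "\<lambda>f p. - f p"
proof -
  fix f :: "'a lpoly \<Rightarrow> 'a lpoly" assume "f \<in> dops"
  then have "(\<lambda>p. (-1) *\<^sub>C f p) \<in> dops" by (rule dops_scaleC)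
  moreover have "(-1) *\<^sub>C f p = - f p" for p
    by (rule poly_mapping_eqI) (simp add: scaleC_complex_def)
  ultimately show "(\<lambda>p. - f p) \<in> dops" by simp
qed
definition "minus_dprime f (g :: 'a dprime) = f + - g"
lift_definition times_dprime :: "'a dprime \<Rightarrow> 'a dprime \<Rightarrow> 'a dprime" is "\<lambda>f g p. f (g p)"
  by (rule dops_mult)
lift_definition scaleC_dprime :: "complex \<Rightarrow> 'a dprime \<Rightarrow> 'a dprime" is "\<lambda>c f p. c *\<^sub>C f p"
  by (rule dops_scaleC)

instance
proof
  show "(0 :: 'a dprime) \<noteq> 1"
  proof
    assume "(0 :: 'a dprime) = 1"
    then have "apply_op (0 :: 'a dprime) 1 = apply_op 1 1" by simp
    then show False by (simp add: zero_dprime.rep_eq one_dprime.rep_eq)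
  qed
qed (rule dprime_eqI, simp add: minus_dprime_def zero_dprime.rep_eq one_dprime.rep_eq
      plus_dprime.rep_eq uminus_dprime.rep_eq times_dprime.rep_eq scaleC_dprime.rep_eq
      add_ac scaleC_add_right scaleC_add_left scaleC_scaleC scaleC_one
      dops_apply_add[OF apply_op] dops_apply_scaleC[OF apply_op])+
end

lemma apply_op_simps [simp]:
  "apply_op 0 p = 0" "apply_op 1 p = p" "apply_op (f + g) p = apply_op f p + apply_op g p"
  "apply_op (- f) p = - apply_op f p" "apply_op (f - g) p = apply_op f p - apply_op g p"
  "apply_op (f * g) p = apply_op f (apply_op g p)" "apply_op (c *\<^sub>C f) p = c *\<^sub>C apply_op f p"
  by (simp_all add: minus_dprime_def zero_dprime.rep_eq one_dprime.rep_eq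
      plus_dprime.rep_eq uminus_dprime.rep_eq times_dprime.rep_eq scaleC_dprime.rep_eq
      del: add_uminus_conv_diff)

lift_definition tratio :: "'n \<Rightarrow> 'n dprime" is "\<lambda>i p. lvar (Some i) * lvar0_inv * p"
  by (rule dops_ratio)

lift_definition tdel :: "'n option \<Rightarrow> 'n option \<Rightarrow> 'n dprime" is "\<lambda>a b p. lvar a * lderiv b p"
proof -
  fix a b :: "'n option"
  show "(\<lambda>p. lvar a * lderiv b p) \<in> dops"
  proof (cases a)
    case None
    then show ?thesis using dops_t0_deriv by simp
  next
    case (Some i)
    have "(\<lambda>p. lvar (Some i) * lvar0_inv * (lvar None * lderiv b p)) \<in> dops"
      by (rule dops_mult[OF dops_ratio dops_t0_deriv])
    moreover have "lvar (Some i) * lvar0_inv * (lvar None * q) = lvar a * q" for q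
      by (simp add: Some mult.assoc lvar0_inv_cancel)
    ultimately show ?thesis by simp
  qed
qed

definition euler :: "'n::finite dprime" where
  "euler = (\<Sum>i\<in>UNIV. tdel i i)"

lemma tdel_commutator:
  "tdel a b * tdel c d - tdel c d * tdel a b
     = (if b = c then tdel a d else 0) - (if d = a then tdel c b else 0)"
  by (rule dprime_eqI) (auto simp: tdel.rep_eq lderiv_mult lderiv_lvar lderiv_commute[of b d] algebra_simps)

lemma tdel_tratio_commutator:
  "tdel a b * tratio c - tratio c * tdel a b
     = (if b = Some c then (case a of None \<Rightarrow> 1 | Some i \<Rightarrow> tratio i) else 0)
       - (if b = None then (case a of None \<Rightarrow> 1 | Some i \<Rightarrow> tratio i) * tratio c else 0)"
proof (rule dprime_eqI)
  fix p :: "'a lpoly"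
  show "apply_op (tdel a b * tratio c - tratio c * tdel a b) p = apply_op
      ((if b = Some c then (case a of None \<Rightarrow> 1 | Some i \<Rightarrow> tratio i) else 0)
       - (if b = None then (case a of None \<Rightarrow> 1 | Some i \<Rightarrow> tratio i) * tratio c else 0)) p"
    by (cases a) (auto simp: tdel.rep_eq tratio.rep_eq lderiv_mult lderiv_lvar lderiv_lvar0_inv
        lvar0_inv_cancel mult_ac distrib_left)
qed

lemma tratio_commute: "tratio a * tratio b = tratio b * tratio a"
  by (rule dprime_eqI) (simp add: tratio.rep_eq mult_ac)

lemma tratio_tdel: "tratio i * tdel None b = tdel (Some i) b"
  by (rule dprime_eqI) (simp add: tdel.rep_eq tratio.rep_eq mult.assoc lvar0_inv_cancel)

section \<open>The homomorphism \<open>\<rho>\<close>\<close>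

definition G1 :: "'i::finite ugl" where
  "G1 = (\<Sum>i\<in>UNIV. Egl i i)"

definition R1 :: "('n::finite dprime, 'n ugl) tensor" where
  "R1 = (- 1 / (of_nat (card (UNIV :: 'n set)) + 1)) *\<^sub>C (euler \<otimes> 1 + 1 \<otimes> G1)"

fun rho_gen :: "'n::finite option \<Rightarrow> 'n option \<Rightarrow> ('n dprime, 'n ugl) tensor" where
  "rho_gen (Some a) (Some b) =
     tdel (Some a) (Some b) \<otimes> 1 + 1 \<otimes> Egl a b + (if a = b then R1 else 0)"
| "rho_gen (Some a) None = tdel (Some a) None \<otimes> 1 - (\<Sum>i\<in>UNIV. tratio i \<otimes> Egl a i)"
| "rho_gen None (Some b) = tdel None (Some b) \<otimes> 1"
| "rho_gen None None = tdel None None \<otimes> 1 + R1"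

definition rho :: "'n::finite option ugl \<Rightarrow> ('n dprime, 'n ugl) tensor" where
  "rho = ugl_lift rho_gen"

text \<open>Well-definedness of \<open>rho\<close>: the images of the generators satisfy the relations of
  $\mathfrak{gl}(n+1)$, so that \<open>rho\<close> is the homomorphism of unital algebras they determine.\<close>

definition comm :: "'a::ring_1 \<Rightarrow> 'a \<Rightarrow> 'a" where
  "comm x y = x * y - y * x"

lemma comm_add_left: "comm (x + y) z = comm x z + comm y z"
  and comm_add_right: "comm z (x + y) = comm z x + comm z y"
  and comm_diff_left: "comm (x - y) z = comm x z - comm y z"
  and comm_diff_right: "comm z (x - y) = comm z x - comm z y"
  and comm_mult_left: "comm (x * y) z = x * comm y z + comm x z * y"
  and comm_mult_right: "comm z (x * y) = comm z x * y + x * comm z y"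
  and comm_swap: "comm x y = - comm y x"
  by (simp_all add: comm_def algebra_simps)

lemma comm_zero [simp]: "comm 0 x = 0" "comm x 0 = 0"
  by (simp_all add: comm_def)

lemma comm_sum_left: "comm (sum f S) z = (\<Sum>s\<in>S. comm (f s) z)"
  by (simp add: comm_def sum_distrib_left sum_distrib_right sum_subtractf)

lemma comm_sum_right: "comm z (sum f S) = (\<Sum>s\<in>S. comm z (f s))"
  by (simp add: comm_def sum_distrib_left sum_distrib_right sum_subtractf)

lemma comm_scaleC_left: "comm (c *\<^sub>C x) z = c *\<^sub>C comm x (z :: 'a::calgebra_1)"
  by (simp add: comm_def mult_scaleC_left mult_scaleC_right scaleC_diff_right)

lemma comm_tens_left: "comm (a \<otimes> 1) (b \<otimes> c) = comm a b \<otimes> c"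
  by (simp add: comm_def tens_mult tens_diff_left)

lemma comm_tens_right: "comm (1 \<otimes> a) (b \<otimes> c) = b \<otimes> comm a c"
  by (simp add: comm_def tens_mult tens_diff_right)

lemma comm_tdel: "comm (tdel a b) (tdel c d) = (if b = c then tdel a d else 0) - (if d = a then tdel c b else 0)"
  unfolding comm_def by (rule tdel_commutator)

lemma comm_Egl: "comm (Egl i j) (Egl k l) = (if j = k then Egl i l else 0) - (if l = i then Egl k j else 0)"
  unfolding comm_def by (rule Egl_commutator)

lemma comm_tdel_Some_tratio: "comm (tdel a (Some b)) (tratio c)
    = (if b = c then (case a of None \<Rightarrow> 1 | Some i \<Rightarrow> tratio i) else 0)"
  unfolding comm_def by (simp add: tdel_tratio_commutator)

lemma comm_tdel_None_tratio: "comm (tdel a None) (tratio c)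
    = - ((case a of None \<Rightarrow> 1 | Some i \<Rightarrow> tratio i) * tratio c)"
  unfolding comm_def by (simp add: tdel_tratio_commutator)

lemma comm_tratio: "comm (tratio a) (tratio b) = 0"
  by (simp add: comm_def tratio_commute)

lemma sum_option: "(\<Sum>i\<in>UNIV. f i) = f None + (\<Sum>i\<in>UNIV. f (Some i :: 'n::finite option))"
  by (simp add: UNIV_option_conv sum.reindex)

lemma comm_euler_tdel: "comm euler (tdel c d) = 0"
  by (simp add: euler_def comm_sum_left comm_tdel sum_subtractf)

lemma comm_euler_tratio: "comm euler (tratio c) = 0"
proof -
  have "comm euler (tratio c) = - tratio c + (\<Sum>i\<in>UNIV. if i = c then tratio i else 0)"
    by (simp add: euler_def sum_option comm_add_left comm_sum_left comm_tdel_Some_tratio comm_tdel_None_tratio)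
  also have "\<dots> = 0" by simp
  finally show ?thesis .
qed

lemma comm_G1_Egl: "comm G1 (Egl c d) = 0"
  by (simp add: G1_def comm_sum_left comm_Egl sum_subtractf)

lemma comm_one [simp]: "comm 1 x = 0" "comm x 1 = 0"
  by (simp_all add: comm_def)

lemma comm_R1:
  "comm R1 (tdel c d \<otimes> 1) = 0" "comm R1 (1 \<otimes> Egl a b) = 0"
  "comm R1 (tratio i \<otimes> Egl a b) = 0"
  by (simp_all add: R1_def comm_scaleC_left comm_add_left comm_tens_left comm_tens_right
      comm_euler_tdel comm_euler_tratio comm_G1_Egl)

lemma comm_self [simp]: "comm x x = 0"
  by (simp add: comm_def)

lemma comm_R1_right:
  "comm (tdel c d \<otimes> 1) R1 = 0" "comm (1 \<otimes> Egl a b) R1 = 0" "comm (tratio i \<otimes> Egl a b) R1 = 0"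
  using comm_R1 by (metis comm_swap neg_equal_0_iff_equal)+

definition tE_sum :: "'n::finite \<Rightarrow> ('n dprime, 'n ugl) tensor" where
  "tE_sum a = (\<Sum>i\<in>UNIV. tratio i \<otimes> Egl a i)"

definition ttE_sum :: "'n::finite \<Rightarrow> 'n \<Rightarrow> ('n dprime, 'n ugl) tensor" where
  "ttE_sum c a = (\<Sum>i\<in>UNIV. (tratio c * tratio i) \<otimes> Egl a i)"

lemma comm_tdel_tE_sum:
  "comm (tdel (Some a) (Some b) \<otimes> 1) (tE_sum c) = tratio a \<otimes> Egl c b"
  "comm (tdel None (Some b) \<otimes> 1) (tE_sum c) = 1 \<otimes> Egl c b"
  "comm (tdel (Some a) None \<otimes> 1) (tE_sum c) = - ttE_sum a c"
  "comm (tdel None None \<otimes> 1) (tE_sum c) = - tE_sum c"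
  by (simp_all add: tE_sum_def ttE_sum_def comm_sum_right comm_tens_left comm_tdel_Some_tratio
      comm_tdel_None_tratio if_distrib[where f = "\<lambda>x. x \<otimes> _"] tens_minus_left sum_negf cong: if_cong)

lemma comm_Egl_tE_sum:
  "comm (1 \<otimes> Egl a b) (tE_sum c) = (if b = c then tE_sum a else 0) - tratio a \<otimes> Egl c b"
  by (simp add: tE_sum_def comm_sum_right comm_tens_right comm_Egl tens_diff_right sum_subtractf
      if_distrib[where f = "\<lambda>x. _ \<otimes> x"] cong: if_cong)

lemma comm_R1_tE_sum: "comm R1 (tE_sum c) = 0"
  by (simp add: tE_sum_def comm_sum_right comm_R1)

lemma comm_tE_sum_tE_sum: "comm (tE_sum a) (tE_sum c) = ttE_sum c a - ttE_sum a c"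
proof -
  have *: "comm (tratio i \<otimes> u) (tratio j \<otimes> v) = (tratio i * tratio j) \<otimes> comm u v" for i j :: 'a and u v :: "'a ugl"
    by (simp add: comm_def tens_mult tens_diff_right tratio_commute[of j i])
  have "comm (tratio i \<otimes> Egl a i) (tE_sum c)
      = (if i = c then ttE_sum c a else 0) - (tratio a * tratio i) \<otimes> Egl c i" for i
    by (simp add: tE_sum_def ttE_sum_def comm_sum_right * comm_Egl tens_diff_right sum_subtractf
        if_distrib[where f = "\<lambda>x. _ \<otimes> x"] tratio_commute[of i a] cong: if_cong)
  then show ?thesis
    by (simp add: tE_sum_def[of a] ttE_sum_def[of a c] comm_sum_left sum_subtractf)
qed

lemma comm_tE_sum_swap:
  "comm (tE_sum c) (tdel a b \<otimes> 1) = - comm (tdel a b \<otimes> 1) (tE_sum c)"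
  "comm (tE_sum c) (1 \<otimes> Egl i j) = - comm (1 \<otimes> Egl i j) (tE_sum c)"
  "comm (tE_sum c) R1 = - comm R1 (tE_sum c)"
  by (rule comm_swap)+

lemma rho_gen_commutator:
  "rho_gen a b * rho_gen c d - rho_gen c d * rho_gen a b
     = (if b = c then rho_gen a d else 0) - (if d = a then rho_gen c b else 0)"
proof -
  have t1: "comm (tdel a b \<otimes> 1) (tdel c d \<otimes> 1) = (if b = c then tdel a d \<otimes> 1 else 0) - (if d = a then tdel c b \<otimes> 1 else 0)"
    for a b c d :: "'a option" 
    by (simp add: comm_tens_left comm_tdel tens_diff_left)
  have t2: "comm (1 \<otimes> Egl i j) (1 \<otimes> Egl k l) = (if j = k then 1 \<otimes> Egl i l else 0) - (if l = i then 1 \<otimes> Egl k j else 0)"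
    for i j k l :: 'a
    by (simp add: comm_tens_right comm_Egl tens_diff_right)
  have t3: "comm (1 \<otimes> Egl i j) (tdel c d \<otimes> 1) = 0" "comm (tdel c d \<otimes> 1) (1 \<otimes> Egl i j) = 0"
    for i j :: 'a and c d
    by (simp_all add: comm_tens_right comm_tens_left)
  note [simp] = t1 t2 t3 comm_R1 comm_R1_right comm_tdel_tE_sum comm_Egl_tE_sum comm_R1_tE_sum
    comm_tE_sum_tE_sum comm_tE_sum_swap
  have "comm (rho_gen a b) (rho_gen c d) = (if b = c then rho_gen a d else 0) - (if d = a then rho_gen c b else 0)"
    by (cases a; cases b; cases c; cases d)
      (auto simp: comm_add_left comm_add_right comm_diff_left comm_diff_right simp flip: tE_sum_def)
  then show ?thesis by (simp add: comm_def)
qed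

lemmas rho_add = ugl_lift_add[of rho_gen, OF rho_gen_commutator, folded rho_def]
  and rho_mult = ugl_lift_mult[of rho_gen, OF rho_gen_commutator, folded rho_def]
  and rho_scaleC = ugl_lift_scaleC[of rho_gen, OF rho_gen_commutator, folded rho_def]
  and rho_one = ugl_lift_one[of rho_gen, OF rho_gen_commutator, folded rho_def]
  and rho_Egl = ugl_lift_Egl[of rho_gen, OF rho_gen_commutator, folded rho_def]

lemma rho_unique:
  fixes f :: "'n::finite option ugl \<Rightarrow> ('n dprime, 'n ugl) tensor"
  assumes "\<And>u v. f (u + v) = f u + f v" "\<And>u v. f (u * v) = f u * f v"
    and "\<And>c u. f (c *\<^sub>C u) = c *\<^sub>C f u" "f 1 = 1" "\<And>a b. f (Egl a b) = rho_gen a b"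
  shows "f = rho"
proof
  fix u :: "'n option ugl"
  obtain x where x: "u = abs_ugl x"
    by (metis Quotient3_abs_rep[OF Quotient3_ugl])
  have "f (abs_ugl x) = rho (abs_ugl x)"
  proof (induction x rule: poly_mapping_single_induct)
    case (add p q)
    then show ?case by (simp add: assms rho_add flip: plus_ugl.abs_eq)
  next
    case (single k c)
    obtain w where k: "k = Word w" by (cases k)
    have "f (abs_ugl (Poly_Mapping.single (Word w) 1)) = rho (abs_ugl (Poly_Mapping.single (Word w) 1))"
    proof (induction w)
      case Nil
      have "abs_ugl (Poly_Mapping.single (Word []) 1) = (1 :: 'n option ugl)"
        by (simp add: one_ugl_def flip: single_one zero_word_def)
      then show ?case by (simp add: assms rho_one)
    next
      case (Cons g w)
      obtain a b where g: "g = (a, b)" by (cases g)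
      have "Poly_Mapping.single (Word (g # w)) 1 = freegen g * (Poly_Mapping.single (Word w) 1 :: _ \<Rightarrow>\<^sub>0 complex)"
        by (simp add: freegen_def mult_single)
      then have "abs_ugl (Poly_Mapping.single (Word (g # w)) 1) = Egl a b * abs_ugl (Poly_Mapping.single (Word w) 1)"
        by (simp add: g Egl.abs_eq times_ugl.abs_eq)
      then show ?case by (simp add: assms rho_mult rho_Egl Cons)
    qed
    moreover have "Poly_Mapping.single k c = c *\<^sub>C Poly_Mapping.single (Word w) (1 :: complex)"
      by (simp add: k scaleC_single scaleC_complex_def)
    ultimately show ?case by (simp add: assms rho_scaleC flip: scaleC_ugl.abs_eq)
  qed
  then show "f u = rho u" by (simp add: x)
qed

section \<open>Polynomials in a central variable and Capelli determinants\<close>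

text \<open>\<open>'a npoly\<close> is \<open>'a[T]\<close> for a possibly noncommutative \<open>'a\<close>, with \<open>T\<close> commuting with the
  coefficients.\<close>

type_synonym 'a npoly = "nat \<Rightarrow>\<^sub>0 'a"

definition pvar :: "'a::ring_1 npoly" where
  "pvar = Poly_Mapping.single 1 1"

definition pconst :: "'a::ring_1 \<Rightarrow> 'a npoly" where
  "pconst a = Poly_Mapping.single 0 a"

text \<open>Substitution of an element that need not commute with the coefficients: powers of the
  argument are put to the right of the coefficients.\<close>

definition peval :: "'a::ring_1 npoly \<Rightarrow> 'a \<Rightarrow> 'a" where
  "peval p x = (\<Sum>k\<in>Poly_Mapping.keys p. Poly_Mapping.lookup p k * x ^ k)"

definition psubst :: "'a::ring_1 npoly \<Rightarrow> 'a npoly \<Rightarrow> 'a npoly" where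
  "psubst p q = (\<Sum>k\<in>Poly_Mapping.keys p. pconst (Poly_Mapping.lookup p k) * q ^ k)"

definition column_det :: "('i::{finite,linorder} \<Rightarrow> 'i \<Rightarrow> 'a::ring_1) \<Rightarrow> 'a" where
  "column_det A = (\<Sum>\<sigma> | \<sigma> permutes UNIV.
     of_int (sign \<sigma>) * prod_list (map (\<lambda>j. A (\<sigma> j) j) (sorted_list_of_set UNIV)))"

text \<open>The position of an index, counted from \<open>0\<close>: this is \<open>i - 1\<close> for the index set
  $\{1,\dots,n\}$ and \<open>i\<close> for $\{0,\dots,n\}$, the diagonal shift of the respective Capelli
  determinant.  In \<open>'n option\<close> the index \<open>None\<close>, i.e. \<open>0\<close>, comes first.\<close>

definition index_pos :: "'i::{finite,linorder} \<Rightarrow> nat" where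
  "index_pos i = card {j. j < i}"

definition capelli :: "'i::{finite,linorder} ugl npoly" where
  "capelli = column_det (\<lambda>i j.
     pconst (Egl i j) - (if i = j then pvar + of_nat (index_pos i) else 0))"

definition C_rho :: "('n::{finite,linorder} dprime, 'n ugl) tensor npoly" where
  "C_rho = Poly_Mapping.map rho (capelli :: 'n option ugl npoly)"

end

theory Submission
  imports Defs
begin

text \<open>
  After the shift of \<open>T\<close> by \<open>R1\<close>, which absorbs the central summands of \<open>rho\<close>, the left-hand
  side is a column determinant whose entries are those of a rank one matrix added to a Capelli
  matrix. Put $x_i = t_i/t_0$, $D_j = t_0\partial_j$, and let $e_0,\dots,e_n$ be exterior generators
  that commute with all coefficients. A column determinant is the coefficient of
  $e_0 e_1\cdots e_n$ in the ordered product of its columns, written as linear forms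
  $\sum_i e_i A_{ij}$; this is \<open>vol_prod_linear_forms\<close>. With
  $\omega = e_0 + \sum_i x_i e_i$ and
  $\eta_j(u) = \sum_{i>0} e_i (E_{ij} - \delta_{ij}u)$ the columns are
  \[ \omega (D_0 - T) - \sum_i x_i\,\eta_i(T) \quad\text{and}\quad
     \omega D_j + \eta_j(T+j), \quad 1 \le j \le n . \]

  Only a few relations are needed. First, $\omega^2 = 0$ and $\omega$ anticommutes with every
  $\eta_j(u)$. Secondly, $[D_j,\omega] = e_j$, and $\eta_j(u+1) = \eta_j(u) - e_j$: the
  commutator that arises when $\omega$ is moved to the left across $D_j$ is therefore absorbed by
  $\eta_j$ as a unit shift of its parameter, which is where the diagonal shifts of the Capelli
  determinant enter. Thirdly, the relations of
  $\mathfrak{gl}(n)$ imply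
  $\eta_i(u)\,\eta_j(u+1) = -\eta_j(u)\,\eta_i(u+1)$ (\<open>eta_swap\<close>), so that
  columns with increasing shifts may be permuted like those of a commutative determinant.

  The product of the last $n$ columns is thus $H + \omega L$, where
  $H = \eta_1(T+1)\cdots\eta_n(T+n)$ equals $e_1\cdots e_n\,C_n(T+1)$ and $L$ is an alternating sum of
  products of $n-1$ factors (\<open>perturbed_eq\<close>), and Laplace expansion gives
  $\eta_i(T+1)\,L = H D_i$ (\<open>eta_omega_part\<close>). In the product with the column of index $0$
  the terms with $n+1$ factors from the span of $e_1,\dots,e_n$ vanish, and what remains is
  $e_0 H (D_0 - T + \sum_i x_i D_i) = (\mathcal E - T)\, e_0 H$
  (\<open>bordered_columns_product\<close>).

  The second assertion follows by evaluating the identity at \<open>T = euler\<close>. Powers of the argument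
  stand to the right of the coefficients, but \<open>euler\<close> commutes with \<open>R1\<close> and with all coefficients
  of the second factor, so the factor $\mathcal E - T$ becomes zero.
\<close>

section \<open>Exterior algebras over noncommutative coefficient rings\<close>

text \<open>The words are the monomials of a free algebra whose letters commute with the coefficient
  ring. The squares are separate relations because \<open>2\<close> may be a zero divisor in that ring.\<close>

definition exterior_relations :: "('i word \<Rightarrow>\<^sub>0 'a::ring_1) set" where
  "exterior_relations =
     {Poly_Mapping.single (Word [i, i]) 1 | i. True} \<union>
     {Poly_Mapping.single (Word [i, j]) 1 + Poly_Mapping.single (Word [j, i]) 1 | i j. True}"

definition ext_rel :: "('i word \<Rightarrow>\<^sub>0 'a::ring_1) \<Rightarrow> ('i word \<Rightarrow>\<^sub>0 'a) \<Rightarrow> bool" where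
  "ext_rel x y \<longleftrightarrow> x - y \<in> tsideal exterior_relations"

quotient_type (overloaded) ('i, 'a) ext = "'i word \<Rightarrow>\<^sub>0 'a::ring_1" / ext_rel
  unfolding ext_rel_def by (rule tsideal_equivp)

lemma word_add_eq_zero_iff: "u + v = (0 :: 'i word) \<longleftrightarrow> u = 0 \<and> v = 0"
  by (cases u; cases v) (simp add: zero_word_def)

lemma lookup_mult_word_zero:
  "Poly_Mapping.lookup (p * q) 0 = Poly_Mapping.lookup p (0 :: 'i word) * Poly_Mapping.lookup q 0"
proof (induction p rule: poly_mapping_single_induct)
  case (single k c)
  show ?case
    by (induction q rule: poly_mapping_single_induct)
      (auto simp: distrib_left lookup_add mult_single lookup_single when_def word_add_eq_zero_iff)
qed (simp add: distrib_right lookup_add)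

text \<open>The constant coefficient is a ring homomorphism that kills the relations; hence the quotient
  is a non-zero ring.\<close>

lemma lookup_exterior_ideal_word_zero:
  assumes "x \<in> tsideal (exterior_relations :: ('i word \<Rightarrow>\<^sub>0 'a::ring_1) set)"
  shows "Poly_Mapping.lookup x 0 = 0"
  using assms
proof induction
  case (base r)
  then show ?case
    by (auto simp: exterior_relations_def lookup_add lookup_single zero_word_def)
qed (simp_all add: lookup_add lookup_mult_word_zero)

instantiation ext :: (type, ring_1) ring_1
begin
lift_definition zero_ext :: "('a, 'b) ext" is 0 .
lift_definition one_ext :: "('a, 'b) ext" is 1 .
lift_definition plus_ext :: "('a, 'b) ext \<Rightarrow> ('a, 'b) ext \<Rightarrow> ('a, 'b) ext" is "(+)"
  unfolding ext_rel_def by (rule tsideal_cong_add)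
lift_definition minus_ext :: "('a, 'b) ext \<Rightarrow> ('a, 'b) ext \<Rightarrow> ('a, 'b) ext" is "(-)"
  unfolding ext_rel_def by (rule tsideal_cong_diff)
lift_definition uminus_ext :: "('a, 'b) ext \<Rightarrow> ('a, 'b) ext" is uminus
  unfolding ext_rel_def by (rule tsideal_cong_minus)
lift_definition times_ext :: "('a, 'b) ext \<Rightarrow> ('a, 'b) ext \<Rightarrow> ('a, 'b) ext" is "(*)"
  unfolding ext_rel_def by (rule tsideal_cong_mult)

instance
proof
  show "(0 :: ('a, 'b) ext) \<noteq> 1"
  proof
    assume "(0 :: ('a, 'b) ext) = 1"
    then have "0 - (1 :: 'a word \<Rightarrow>\<^sub>0 'b) \<in> tsideal exterior_relations"
      by (simp add: zero_ext_def one_ext_def ext.abs_eq_iff ext_rel_def)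
    from lookup_exterior_ideal_word_zero[OF this] show False by (simp add: lookup_one)
  qed
qed (transfer, simp add: ext_rel_def tsideal.zero algebra_simps)+
end

text \<open>The embedding of the coefficients and the exterior generators.\<close>

lift_definition cst :: "'a::ring_1 \<Rightarrow> ('i, 'a) ext" is "Poly_Mapping.single 0" .

lift_definition gen :: "'i \<Rightarrow> ('i, 'a::ring_1) ext" is "\<lambda>i. Poly_Mapping.single (Word [i]) 1" .

lemma cst_add: "cst (a + b) = cst a + cst b"
  by transfer (simp add: ext_rel_def tsideal.zero single_add)

lemma cst_mult: "cst (a * b) = cst a * cst b"
  by transfer (simp add: ext_rel_def tsideal.zero mult_single)

lemma cst_one [simp]: "cst 1 = 1"
  by transfer (simp add: ext_rel_def tsideal.zero)

lemma cst_zero [simp]: "cst 0 = 0"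
  by transfer (simp add: ext_rel_def tsideal.zero)

lemma cst_minus: "cst (- a) = - cst a"
  by (metis add.right_inverse cst_add cst_zero minus_unique)

lemma cst_diff: "cst (a - b) = cst a - cst b"
  by (metis diff_conv_add_uminus cst_add cst_minus)

lemma cst_sum: "cst (sum f S) = (\<Sum>s\<in>S. cst (f s))"
  by (induction S rule: infinite_finite_induct) (auto simp: cst_add)

lemma cst_gen_commute: "cst r * gen i = gen i * cst r"
  by transfer (simp add: ext_rel_def tsideal.zero mult_single)

lemma gen_square: "gen i * gen i = (0 :: ('i, 'a::ring_1) ext)"
proof (transfer, unfold ext_rel_def)
  fix i :: 'i
  have "Poly_Mapping.single (Word [i, i]) 1 \<in> tsideal (exterior_relations :: ('i word \<Rightarrow>\<^sub>0 'a) set)"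
    by (rule tsideal.base) (auto simp: exterior_relations_def)
  then show "Poly_Mapping.single (Word [i]) 1 * Poly_Mapping.single (Word [i]) 1 - 0
      \<in> tsideal (exterior_relations :: ('i word \<Rightarrow>\<^sub>0 'a) set)"
    by (simp add: mult_single)
qed

lemma gen_anticommute: "gen i * gen j = - (gen j * gen i :: ('i, 'a::ring_1) ext)"
proof (transfer, unfold ext_rel_def)
  fix i j :: 'i
  have "Poly_Mapping.single (Word [i, j]) 1 + Poly_Mapping.single (Word [j, i]) 1
      \<in> tsideal (exterior_relations :: ('i word \<Rightarrow>\<^sub>0 'a) set)"
    by (rule tsideal.base) (auto simp: exterior_relations_def)
  then show "Poly_Mapping.single (Word [i]) 1 * Poly_Mapping.single (Word [j]) 1
        - - (Poly_Mapping.single (Word [j]) 1 * Poly_Mapping.single (Word [i]) 1)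
      \<in> tsideal (exterior_relations :: ('i word \<Rightarrow>\<^sub>0 'a) set)"
    by (simp add: mult_single)
qed

text \<open>The coefficient of the product of all generators in increasing order, before passage to the
  quotient: a word that permutes the generators contributes with the sign of the permutation, and
  all other words contribute nothing.\<close>

definition word_vol :: "('i::{finite,linorder} word \<Rightarrow>\<^sub>0 'a::ring_1) \<Rightarrow> 'a" where
  "word_vol p = (\<Sum>\<sigma> | \<sigma> permutes UNIV.
     of_int (sign \<sigma>) * Poly_Mapping.lookup p (Word (map \<sigma> (sorted_list_of_set UNIV))))"

lemma word_vol_add: "word_vol (p + q) = word_vol p + word_vol q"
  by (simp add: word_vol_def lookup_add distrib_left sum.distrib)

lemma word_vol_diff: "word_vol (p - q) = word_vol p - word_vol q"
  by (simp add: word_vol_def lookup_minus right_diff_distrib sum_subtractf)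

lemma word_vol_zero [simp]: "word_vol 0 = 0"
  by (simp add: word_vol_def)

lemma word_vol_not_distinct:
  assumes "\<not> distinct w"
  shows "word_vol (Poly_Mapping.single (Word w) c) = 0"
proof -
  have "w \<noteq> map \<sigma> (sorted_list_of_set UNIV)" if "\<sigma> permutes UNIV" for \<sigma> :: "'a \<Rightarrow> 'a"
    using assms permutes_inj[OF that] by (auto simp: distinct_map inj_on_def inj_def)
  then show ?thesis by (auto simp: word_vol_def lookup_single when_def intro!: sum.neutral)
qed

text \<open>Interchanging two distinct adjacent letters of a word without repetitions composes the
  permutation that it spells with a transposition. In all other cases both sides vanish.\<close>

lemma word_vol_swap:
  "word_vol (Poly_Mapping.single (Word (u @ [i :: 'i::{finite,linorder}, j] @ v)) (c :: 'a::ring_1))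
     = - word_vol (Poly_Mapping.single (Word (u @ [j, i] @ v)) c)"
proof (cases "distinct (u @ [i, j] @ v)")
  case False
  then have "\<not> distinct (u @ [j, i] @ v)" by auto
  with False show ?thesis by (simp add: word_vol_not_distinct)
next
  case True
  define L where "L = sorted_list_of_set (UNIV :: 'i set)"
  let ?t = "transpose i j"
  have tt: "?t \<circ> (?t \<circ> \<sigma>) = \<sigma>" for \<sigma> :: "'i \<Rightarrow> 'i" by (simp add: fun_eq_iff)
  have inj_t: "inj ?t" by (rule inj_on_inverseI[of _ ?t]) simp
  have "map ?t u = u" "map ?t v = v"
    using True by (auto intro!: map_idI simp: transpose_def)
  then have swap: "map ?t (u @ [i, j] @ v) = u @ [j, i] @ v" by simp
  have "word_vol (Poly_Mapping.single (Word (u @ [i, j] @ v)) c)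
      = (\<Sum>\<sigma> | \<sigma> permutes UNIV. of_int (sign \<sigma>) * (c when u @ [i, j] @ v = map \<sigma> L))"
    by (simp add: word_vol_def lookup_single L_def)
  also have "\<dots> = (\<Sum>\<sigma> | \<sigma> permutes UNIV. - (of_int (sign \<sigma>) * (c when u @ [j, i] @ v = map \<sigma> L)))"
  proof (rule sum.reindex_bij_witness[where i = "\<lambda>\<sigma>. ?t \<circ> \<sigma>" and j = "\<lambda>\<sigma>. ?t \<circ> \<sigma>"])
    fix \<sigma> :: "'i \<Rightarrow> 'i"
    assume "\<sigma> \<in> {\<sigma>. \<sigma> permutes UNIV}"
    then have p: "\<sigma> permutes UNIV" by simp
    show "?t \<circ> \<sigma> \<in> {\<sigma>. \<sigma> permutes UNIV}"
      using permutes_compose[OF p permutes_swap_id[of i UNIV j]] by simp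
    then show "?t \<circ> \<sigma> \<in> {\<sigma>. \<sigma> permutes UNIV}" .
    show "?t \<circ> (?t \<circ> \<sigma>) = \<sigma>" "?t \<circ> (?t \<circ> \<sigma>) = \<sigma>" by (rule tt)+
    have s: "sign (?t \<circ> \<sigma>) = - sign \<sigma>"
      using True sign_compose[of ?t \<sigma>] permutes_imp_permutation[OF finite p]
        permutation_swap_id[of i j]
      by (auto simp: sign_swap_id)
    have e: "u @ [j, i] @ v = map (?t \<circ> \<sigma>) L \<longleftrightarrow> u @ [i, j] @ v = map \<sigma> L"
      by (simp only: swap[symmetric] list.map_comp[symmetric] inj_map_eq_map[OF inj_t])
    show "- (of_int (sign (?t \<circ> \<sigma>)) * (c when u @ [j, i] @ v = map (?t \<circ> \<sigma>) L))
        = of_int (sign \<sigma>) * (c when u @ [i, j] @ v = map \<sigma> L)"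
      unfolding s e by simp
  qed
  also have "\<dots> = - word_vol (Poly_Mapping.single (Word (u @ [j, i] @ v)) c)"
    by (simp add: word_vol_def lookup_single L_def sum_negf)
  finally show ?thesis .
qed

text \<open>By additivity it suffices to treat a relation multiplied by monomials from both sides, and
  there the two preceding lemmas apply.\<close>

lemma word_vol_exterior_ideal:
  assumes "z \<in> tsideal (exterior_relations :: ('i::{finite,linorder} word \<Rightarrow>\<^sub>0 'a::ring_1) set)"
  shows "word_vol z = 0"
proof -
  have mono: "word_vol (Poly_Mapping.single k c * r * Poly_Mapping.single l d) = 0"
    if "r \<in> exterior_relations" for r :: "'i word \<Rightarrow>\<^sub>0 'a" and k l c d
  proof -
    obtain u v where k: "k = Word u" and l: "l = Word v" by (cases k; cases l)
    from that consider i where "r = Poly_Mapping.single (Word [i, i]) 1"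
      | i j where "r = Poly_Mapping.single (Word [i, j]) 1 + Poly_Mapping.single (Word [j, i]) 1"
      unfolding exterior_relations_def by blast
    then show ?thesis
    proof cases
      case 1
      then show ?thesis by (simp add: k l mult_single word_vol_not_distinct)
    next
      case 2
      then show ?thesis
        using word_vol_swap[of u i j v "c * d"]
        by (simp add: k l mult_single distrib_left distrib_right word_vol_add)
    qed
  qed
  have base: "word_vol (x * r * y) = 0" if r: "r \<in> exterior_relations" for r x y :: "'i word \<Rightarrow>\<^sub>0 'a"
  proof (induction x rule: poly_mapping_single_induct)
    case (single k c)
    show ?case
      by (induction y rule: poly_mapping_single_induct) (auto simp: mono r distrib_left word_vol_add)
  qed (simp add: distrib_right word_vol_add)
  have "\<forall>x y. word_vol (x * z * y) = 0"
    using assms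
  proof induction
    case (mult_left z a)
    then show ?case by (metis mult.assoc)
  next
    case (mult_right z a)
    then show ?case by (metis mult.assoc)
  qed (auto simp: base distrib_left distrib_right word_vol_add)
  from this[rule_format, of 1 1] show ?thesis by simp
qed

lift_definition vol :: "('i::{finite,linorder}, 'a::ring_1) ext \<Rightarrow> 'a" is word_vol
proof -
  fix p q :: "'i word \<Rightarrow>\<^sub>0 'a" assume "ext_rel p q"
  from word_vol_exterior_ideal[OF this[unfolded ext_rel_def]]
  show "word_vol p = word_vol q" by (simp add: word_vol_diff)
qed

lemma lookup_single_zero_mult:
  "Poly_Mapping.lookup (Poly_Mapping.single (0 :: 'i word) r * p) w = r * Poly_Mapping.lookup p w"
  by (induction p rule: poly_mapping_single_induct)
    (auto simp: distrib_left lookup_add mult_single lookup_single when_def)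

lemma vol_cst_mult: "vol (cst r * y) = r * vol (y :: ('i::{finite,linorder}, 'a::ring_1) ext)"
proof transfer
  fix r :: 'a and y :: "'i word \<Rightarrow>\<^sub>0 'a"
  have "of_int m * (r * s) = r * (of_int m * s)" for m and s :: 'a
    by (metis mult.assoc mult_of_int_commute)
  then show "word_vol (Poly_Mapping.single 0 r * y) = r * word_vol y"
    by (simp add: word_vol_def lookup_single_zero_mult sum_distrib_left)
qed

definition linear_form :: "('i::finite \<Rightarrow> 'a::ring_1) \<Rightarrow> ('i, 'a) ext" where
  "linear_form a = (\<Sum>i\<in>UNIV. gen i * cst (a i))"

lemma linear_form_abs: 
  "linear_form a = abs_ext (\<Sum>i\<in>UNIV. Poly_Mapping.single (Word [i]) (a i))"
proof -
  have "(\<Sum>i\<in>S. gen i * cst (a i)) = abs_ext (\<Sum>i\<in>S. Poly_Mapping.single (Word [i]) (a i))" if "finite S" for S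
    using that
    by induction (simp_all add: zero_ext_def plus_ext.abs_eq[symmetric] gen.abs_eq cst.abs_eq
        times_ext.abs_eq mult_single)
  then show ?thesis by (simp add: linear_form_def)
qed

lemma lookup_letter_mult:
  "Poly_Mapping.lookup (Poly_Mapping.single (Word [i]) a * p) (Word (j # w))
     = (a when i = j) * Poly_Mapping.lookup p (Word w)"
proof (induction p rule: poly_mapping_single_induct)
  case (single k c)
  show ?case by (cases k) (auto simp: mult_single lookup_single when_def)
qed (simp add: distrib_left lookup_add)

lemma lookup_prod_linear_forms:
  "Poly_Mapping.lookup (prod_list (map (\<lambda>j. \<Sum>i\<in>UNIV. Poly_Mapping.single (Word [i]) (A i j)) js))
      (Word (map \<sigma> js))
     = prod_list (map (\<lambda>j. A (\<sigma> j :: 'i::finite) j) js)"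
proof (induction js)
  case (Cons j js)
  have "(\<Sum>i\<in>UNIV. (A i j when i = \<sigma> j) * r) = A (\<sigma> j) j * r" for r
    by (simp add: when_def if_distrib[where f = "\<lambda>x. x * _"] cong: if_cong)
  with Cons show ?case
    by (simp add: sum_distrib_right lookup_sum lookup_letter_mult)
qed (simp add: zero_word_def[symmetric])

text \<open>The ordered product of the columns expands, before any reordering of generators, into words
  whose coefficients are exactly the ordered products of entries in the column determinant. This
  translates column determinants over noncommutative rings into products.\<close>

lemma vol_prod_linear_forms:
  "vol (prod_list (map (\<lambda>j. linear_form (\<lambda>i. A i j)) (sorted_list_of_set UNIV))) = column_det A"
proof -
  have "prod_list (map (\<lambda>j. linear_form (\<lambda>i. A i j)) js) = abs_ext (prod_list
      (map (\<lambda>j. \<Sum>i\<in>UNIV. Poly_Mapping.single (Word [i]) (A i j)) js))" for js :: "'b list"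
    by (induction js) (simp_all add: one_ext_def linear_form_abs times_ext.abs_eq)
  then show ?thesis
    by (simp add: vol.abs_eq word_vol_def column_det_def lookup_prod_linear_forms)
qed

section \<open>Column determinants of block triangular matrices\<close>

lemma sorted_list_option:
  "sorted_list_of_set (UNIV :: 'n::{finite,linorder} option set)
     = None # map Some (sorted_list_of_set UNIV)"
proof (rule sorted_distinct_set_unique)
  show "sorted (None # map Some (sorted_list_of_set (UNIV :: 'n set)))"
    by (simp add: sorted_map)
  show "set (sorted_list_of_set (UNIV :: 'n option set)) = set (None # map Some (sorted_list_of_set UNIV))"
    by (subst set_sorted_list_of_set) (simp_all add: UNIV_option_conv)
qed (auto simp: distinct_map)

lemma permutes_UNIV_option_fixing_None:
  "{\<sigma>. \<sigma> permutes (UNIV :: 'n option set) \<and> \<sigma> None = None} = {\<sigma>. \<sigma> permutes range Some}"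
proof (intro set_eqI iffI; clarify)
  fix \<sigma> :: "'n option \<Rightarrow> 'n option"
  assume p: "\<sigma> permutes UNIV" and None: "\<sigma> None = None"
  show "\<sigma> permutes range Some"
  proof (rule permutes_superset[OF p])
    show "\<sigma> x = x" if "x \<in> UNIV - range Some" for x
      using that None by (cases x) auto
  qed
next
  fix \<sigma> :: "'n option \<Rightarrow> 'n option"
  assume "\<sigma> permutes range Some"
  then show "\<sigma> permutes UNIV \<and> \<sigma> None = None"
    by (auto intro: permutes_subset permutes_not_in)
qed

text \<open>Only permutations that fix the index \<open>None\<close> contribute, and these are the permutations of
  the other indices, with the same signs.\<close>

lemma column_det_block:
  fixes B :: "'n::{finite,linorder} option \<Rightarrow> 'n option \<Rightarrow> 'a::ring_1"
  assumes "B None None = 1" "\<And>i. B (Some i) None = 0"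
  shows "column_det B = column_det (\<lambda>i j. B (Some i) (Some j))"
proof -
  define L where "L = sorted_list_of_set (UNIV :: 'n set)"
  let ?f = "\<lambda>\<sigma>. of_int (sign \<sigma>) * (B (\<sigma> None) None * prod_list (map (\<lambda>j. B (\<sigma> (Some j)) (Some j)) L))"
  have "column_det B = sum ?f {\<sigma>. \<sigma> permutes UNIV}"
    by (simp add: column_det_def sorted_list_option L_def o_def)
  also have "\<dots> = sum ?f {\<sigma>. \<sigma> permutes (UNIV :: 'n option set) \<and> \<sigma> None = None}"
  proof (rule sum.mono_neutral_right)
    show "\<forall>\<sigma>\<in>{\<sigma>. \<sigma> permutes UNIV} - {\<sigma>. \<sigma> permutes UNIV \<and> \<sigma> None = None}. ?f \<sigma> = 0"
    proof
      fix \<sigma> :: "'n option \<Rightarrow> 'n option"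
      assume "\<sigma> \<in> {\<sigma>. \<sigma> permutes UNIV} - {\<sigma>. \<sigma> permutes UNIV \<and> \<sigma> None = None}"
      then show "?f \<sigma> = 0" using assms(2) by (cases "\<sigma> None") auto
    qed
  qed (auto intro: finite_permutations)
  also have "\<dots> = sum ?f {\<sigma>. \<sigma> permutes range Some}"
    by (simp only: permutes_UNIV_option_fixing_None)
  also have "\<dots> = (\<Sum>\<sigma> | \<sigma> permutes (UNIV :: 'n set). ?f (map_permutation UNIV Some \<sigma>))"
  proof -
    have "map_permutation UNIV Some
        = (\<lambda>\<sigma> x. if x \<in> range Some then Some (\<sigma> (inv_into UNIV Some x)) else x :: 'n option)"
      by (simp add: map_permutation_def restrict_id_def fun_eq_iff)
    then have "bij_betw (map_permutation UNIV Some)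
        {\<sigma>. \<sigma> permutes (UNIV :: 'n set)} {\<sigma>. \<sigma> permutes range Some}"
      using bij_betw_permutations[of Some "UNIV :: 'n set" "range Some"] by (simp add: bij_betw_def)
    then show ?thesis by (rule sum.reindex_bij_betw[symmetric])
  qed
  also have "\<dots> = column_det (\<lambda>i j. B (Some i) (Some j))"
    unfolding column_det_def
  proof (rule sum.cong[OF refl])
    fix \<sigma> :: "'n \<Rightarrow> 'n" assume "\<sigma> \<in> {\<sigma>. \<sigma> permutes UNIV}"
    then have p: "\<sigma> permutes UNIV" by simp
    then have "map_permutation UNIV Some \<sigma> permutes range Some"
      by (intro map_permutation_permutes) (simp_all add: bij_betw_def)
    then have "map_permutation UNIV Some \<sigma> None = None"
      by (rule permutes_not_in) auto
    moreover have "map_permutation UNIV Some \<sigma> (Some j) = Some (\<sigma> j)" for j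
      by (rule map_permutation_apply) auto
    ultimately show "?f (map_permutation UNIV Some \<sigma>) = of_int (sign \<sigma>) *
        prod_list (map (\<lambda>j. B (Some (\<sigma> j)) (Some j)) (sorted_list_of_set UNIV))"
      by (simp add: sign_map_permutation p assms(1) L_def)
  qed
  finally show ?thesis .
qed

section \<open>Products of linear forms\<close>

lemma ext_double_zero:
  fixes y :: "('i, 'a::calgebra_1) ext"
  assumes "y + y = 0"
  shows "y = 0"
proof -
  have "(1 / 2 :: complex) *\<^sub>C (1 :: 'a) + (1 / 2) *\<^sub>C 1 = 1"
    by (simp add: scaleC_one flip: scaleC_add_left)
  then have "y = (cst ((1 / 2) *\<^sub>C 1) + cst ((1 / 2) *\<^sub>C 1)) * y"
    by (simp flip: cst_add)
  also have "\<dots> = cst ((1 / 2) *\<^sub>C 1) * (y + y)"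
    by (simp only: distrib_left distrib_right)
  finally show ?thesis using assms by simp
qed

lemma linear_form_add: "linear_form (\<lambda>i. a i + b i) = linear_form a + linear_form b"
  by (simp add: linear_form_def cst_add distrib_left sum.distrib)

lemma linear_form_diff: "linear_form (\<lambda>i. a i - b i) = linear_form a - linear_form b"
  by (simp add: linear_form_def cst_diff right_diff_distrib sum_subtractf)

lemma linear_form_sum: "linear_form (\<lambda>i. \<Sum>s\<in>S. a s i) = (\<Sum>s\<in>S. linear_form (a s))"
  unfolding linear_form_def cst_sum sum_distrib_left by (rule sum.swap)

lemma linear_form_mult_cst: "linear_form (\<lambda>i. a i * r) = linear_form a * cst r"
  by (simp add: linear_form_def cst_mult sum_distrib_right mult.assoc)

lemma linear_form_cst_mult: "linear_form (\<lambda>i. r * a i) = cst r * linear_form a"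
  by (simp add: linear_form_def cst_mult sum_distrib_left mult.assoc[symmetric] cst_gen_commute)

lemma linear_form_unit: "linear_form (\<lambda>i. if i = k then 1 else 0) = gen k"
  by (simp add: linear_form_def if_distrib[where f = cst] if_distrib[where f = "\<lambda>x. _ * x"] cong: if_cong)

lemma linear_form_mult:
  "linear_form a * linear_form b = (\<Sum>i\<in>UNIV. \<Sum>j\<in>UNIV. gen i * gen j * cst (a i * b j))"
proof -
  have "gen i * cst (a i) * (gen j * cst (b j)) = gen i * gen j * cst (a i * b j)" for i j
    by (metis cst_gen_commute cst_mult mult.assoc)
  then show ?thesis by (simp add: linear_form_def sum_product)
qed

lemma linear_form_anticommute:
  assumes "\<And>i j. a i * b j = b j * a i"
  shows "linear_form a * linear_form b = - (linear_form b * linear_form a)"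
proof -
  have "linear_form a * linear_form b = (\<Sum>i\<in>UNIV. \<Sum>j\<in>UNIV. - (gen j * gen i * cst (b j * a i)))"
    unfolding linear_form_mult assms by (subst gen_anticommute) simp
  also have "\<dots> = - (\<Sum>j\<in>UNIV. \<Sum>i\<in>UNIV. gen j * gen i * cst (b j * a i))"
    unfolding sum_negf by (subst sum.swap) rule
  finally show ?thesis by (simp add: linear_form_mult)
qed

text \<open>Interchanging the two summation indices changes the sign of the sum, by symmetry of the
  coefficients and anticommutativity of the generators. All quadratic relations among linear forms
  that follow are reduced to the symmetry of a coefficient matrix in this way.\<close>

lemma alternating_sum_symmetric:
  fixes s :: "'i::finite \<Rightarrow> 'i \<Rightarrow> 'a::calgebra_1"
  assumes "\<And>i j. s i j = s j i"
  shows "(\<Sum>i\<in>UNIV. \<Sum>j\<in>UNIV. gen i * gen j * cst (s i j)) = 0" (is "?X = 0")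
proof (rule ext_double_zero)
  have "?X = (\<Sum>i\<in>UNIV. \<Sum>j\<in>UNIV. - (gen j * gen i * cst (s j i)))"
    by (subst gen_anticommute, subst assms) simp
  also have "\<dots> = - ?X"
    unfolding sum_negf by (subst sum.swap) rule
  finally show "?X + ?X = 0" by (rule eq_neg_iff_add_eq_0[THEN iffD1])
qed

lemma linear_form_square:
  fixes a :: "'i::finite \<Rightarrow> 'a::calgebra_1"
  assumes "\<And>i j. a i * a j = a j * a i"
  shows "linear_form a * linear_form a = 0"
  unfolding linear_form_mult by (rule alternating_sum_symmetric) (rule assms)

text \<open>The first of two equal generators can be moved, up to sign, next to the second one.\<close>

lemma prod_gen_not_distinct:
  assumes "\<not> distinct is"
  shows "prod_list (map gen is) = (0 :: ('i, 'a::ring_1) ext)"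
proof -
  have *: "gen i * prod_list (map gen js) * gen i = (0 :: ('i, 'a) ext)" for i js
  proof (induction js)
    case (Cons j js)
    have "gen i * (gen j * prod_list (map gen js)) * gen i
        = - (gen j * (gen i * prod_list (map gen js) * gen i) :: ('i, 'a) ext)"
      unfolding mult.assoc[symmetric] gen_anticommute[of i j] by simp
    then show ?case by (simp add: Cons)
  qed (simp add: gen_square)
  from not_distinct_decomp[OF assms] obtain us vs ws i where "is = us @ [i] @ vs @ [i] @ ws" by blast
  then have "(prod_list (map gen is) :: ('i, 'a) ext)
      = prod_list (map gen us) * (gen i * prod_list (map gen vs) * gen i) * prod_list (map gen ws)"
    by (simp add: mult.assoc)
  then show ?thesis by (simp add: *)
qed

section \<open>Vanishing for reasons of degree\<close>

text \<open>With \<open>n\<close> generators other than \<open>gen None\<close>, products of \<open>n + 1 - m\<close> linear forms in these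
  generators satisfy \<open>killed_by m\<close>. The predicate is a substitute for a grading: it decreases by
  one with every such factor, and \<open>killed_by 0\<close> means zero.\<close>

definition killed_by :: "nat \<Rightarrow> ('n option, 'a::ring_1) ext \<Rightarrow> bool" where
  "killed_by m y \<longleftrightarrow> (\<forall>is. length is = m \<longrightarrow> prod_list (map (\<lambda>i. gen (Some i)) is) * y = 0)"

text \<open>The starting point, by the pigeonhole principle: it holds for every \<open>y\<close>.\<close>

lemma killed_by_Suc_card: "killed_by (Suc (card (UNIV :: 'n::finite set))) (y :: ('n option, 'a::ring_1) ext)"
  unfolding killed_by_def
proof (intro allI impI)
  fix "is" :: "'n list"
  assume "length is = Suc (card (UNIV :: 'n set))"
  then have "\<not> distinct is"
    using card_mono[of UNIV "set is"] by (auto simp flip: distinct_card)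
  then have "\<not> distinct (map Some is)" by (simp add: distinct_map)
  from prod_gen_not_distinct[OF this] have "prod_list (map (\<lambda>i. gen (Some i)) is) = (0 :: ('n option, 'a) ext)"
    by (simp add: o_def)
  then show "prod_list (map (\<lambda>i. gen (Some i)) is) * y = 0" by simp
qed

lemma cst_prod_gen_commute: "cst r * prod_list (map gen js) = prod_list (map gen js) * cst r"
proof (induction js)
  case (Cons j js)
  have "cst r * (gen j * P) = gen j * (cst r * P)" for P :: "('a, 'b) ext"
    by (simp only: mult.assoc[symmetric] cst_gen_commute)
  then show ?case by (simp add: Cons mult.assoc)
qed simp

lemma killed_by_linear_form_mult:
  assumes "killed_by (Suc m) y" "a None = 0"
  shows "killed_by m (linear_form a * y)"
  unfolding killed_by_def
proof (intro allI impI)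
  fix "is" :: "'a list"
  assume "length is = m"
  define P where "P = (prod_list (map (\<lambda>i. gen (Some i)) is) :: ('a option, 'b) ext)"
  have "P * (gen k * cst (a k)) * y = 0" for k
  proof (cases k)
    case (Some i)
    have "P * gen k = prod_list (map gen (map Some (is @ [i])))"
      by (simp add: P_def Some o_def)
    then have c: "P * gen k * cst r = cst r * (P * gen k)" for r
      by (simp only: cst_prod_gen_commute)
    have "P * gen k * y = prod_list (map (\<lambda>i. gen (Some i)) (is @ [i])) * y"
      by (simp add: P_def Some mult.assoc)
    also have "\<dots> = 0"
      using assms(1)[unfolded killed_by_def, rule_format, of "is @ [i]"] \<open>length is = m\<close> by simp
    finally have "cst (a k) * (P * gen k * y) = 0" by simp
    then show ?thesis by (simp only: mult.assoc[symmetric] c)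
  qed (simp add: assms)
  then show "prod_list (map (\<lambda>i. gen (Some i)) is) * (linear_form a * y) = 0"
    by (simp add: P_def[symmetric] linear_form_def sum_distrib_left sum_distrib_right mult.assoc)
qed

lemma killed_by_diff: "killed_by m y \<Longrightarrow> killed_by m z \<Longrightarrow> killed_by m (y - z)"
  by (simp add: killed_by_def right_diff_distrib)

lemma killed_by_mult_right: "killed_by m y \<Longrightarrow> killed_by m (y * z)"
  by (simp add: killed_by_def mult.assoc[symmetric])

lemma killed_by_0: "killed_by 0 y \<longleftrightarrow> y = 0"
  by (simp add: killed_by_def)

section \<open>Positions in a linear order\<close>

lemma map_index_pos:
  "map index_pos (sorted_list_of_set (UNIV :: 'i::{finite,linorder} set)) = [0..<card (UNIV :: 'i set)]"
proof (rule nth_equalityI)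
  define L where "L = sorted_list_of_set (UNIV :: 'i set)"
  have L: "set L = UNIV" "distinct L" "sorted_wrt (<) L"
    by (simp_all add: L_def)
  fix p assume "p < length (map index_pos (sorted_list_of_set (UNIV :: 'i set)))"
  then have p: "p < length L" by (simp add: L_def)
  have "{j. j < L ! p} = (!) L ` {..<p}"
  proof (intro set_eqI iffI)
    fix j assume "j \<in> {j. j < L ! p}"
    moreover from L(1) obtain q where q: "q < length L" "j = L ! q"
      by (metis UNIV_I in_set_conv_nth)
    ultimately have "q < p"
      using sorted_wrt_nth_less[OF L(3), of p q] p by (metis linorder_neqE_nat mem_Collect_eq order_less_asym)
    with q show "j \<in> (!) L ` {..<p}" by blast
  qed (use p in \<open>auto intro: sorted_wrt_nth_less[OF L(3)]\<close>)
  moreover have "inj_on ((!) L) {..<p}"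
    using L(2) p by (auto intro!: inj_on_nth)
  ultimately show "map index_pos (sorted_list_of_set (UNIV :: 'i set)) ! p = [0..<card (UNIV :: 'i set)] ! p"
    using p by (simp add: L_def[symmetric] index_pos_def card_image) (simp add: L_def)
qed simp

section \<open>A rank one perturbation of a Capelli matrix\<close>

text \<open>The hypotheses isolate what the determinant computation uses: a matrix \<open>E\<close> with the relations
  of $\mathfrak{gl}(n)$, a vector \<open>x\<close> of commuting elements, and elements \<open>D\<close>, \<open>D0\<close> acting on \<open>x\<close>
  as $t_0\partial_j$ and $t_0\partial_0$ act on the $t_i/t_0$. The variable \<open>T\<close> is an element like
  the others.\<close>

locale gl_weyl =
  fixes E :: "'n::{finite,linorder} \<Rightarrow> 'n \<Rightarrow> 'a::calgebra_1"
    and x D :: "'n \<Rightarrow> 'a" and D0 T :: 'a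
  assumes E_E: "E i j * E k l - E k l * E i j = (if j = k then E i l else 0) - (if l = i then E k j else 0)"
    and x_x: "x i * x j = x j * x i"
    and D_x: "D j * x i = x i * D j + (if i = j then 1 else 0)"
    and D0_x: "D0 * x i = x i * D0 - x i"
    and x_E: "x k * E i j = E i j * x k"
    and D_E: "D k * E i j = E i j * D k"
    and D0_E: "D0 * E i j = E i j * D0"
    and T_E: "T * E i j = E i j * T"
    and x_T: "x i * T = T * x i"
    and D_T: "D i * T = T * D i"
    and D0_T: "D0 * T = T * D0"
begin

definition shifted :: "nat \<Rightarrow> 'n \<Rightarrow> 'n \<Rightarrow> 'a" where
  "shifted k i j = E i j - (if i = j then T + of_nat k else 0)"

definition eta :: "nat \<Rightarrow> 'n \<Rightarrow> ('n option, 'a) ext" where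
  "eta k j = linear_form (case_option 0 (\<lambda>i. shifted k i j))"

definition omega :: "('n option, 'a) ext" where
  "omega = linear_form (case_option 1 x)"

lemma shifted_Suc: "shifted (Suc k) i j = shifted k i j - (if i = j then 1 else 0)"
  by (simp add: shifted_def)

text \<open>Subtracting a central element from the diagonal does not affect the relations of
  $\mathfrak{gl}(n)$: on the right-hand side the two corrections cancel.\<close>

lemma shifted_commutator:
  "shifted k i j * shifted k l m = shifted k l m * shifted k i j
     + (if j = l then shifted k i m else 0) - (if m = i then shifted k l j else 0)"
proof -
  have T: "(T + of_nat k) * E i j = E i j * (T + of_nat k)" for i j
    by (simp add: distrib_left distrib_right T_E mult_of_nat_commute)
  have "shifted k i j * shifted k l m - shifted k l m * shifted k i j
      = E i j * E l m - E l m * E i j"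
    by (simp add: shifted_def T left_diff_distrib right_diff_distrib)
  also have "\<dots> = (if j = l then shifted k i m else 0) - (if m = i then shifted k l j else 0)"
    unfolding E_E by (auto simp: shifted_def)
  finally show ?thesis by (simp add: algebra_simps)
qed

text \<open>The difference of the two sides has coefficients that are symmetric in the two row indices: the
  commutators of the entries produce linear terms, and the unit difference between the two shifts
  cancels precisely these.\<close>

lemma eta_swap: "eta k i * eta (Suc k) j = - (eta k j * eta (Suc k) i)"
proof -
  define s where "s a c = case_option 0 (\<lambda>a. shifted k a i) a * case_option 0 (\<lambda>c. shifted (Suc k) c j) c
    + case_option 0 (\<lambda>a. shifted k a j) a * case_option 0 (\<lambda>c. shifted (Suc k) c i) c" for a c
  have "s a c = s c a" for a c
  proof (cases a; cases c)
    fix b d assume "a = Some b" "c = Some d"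
    then show ?thesis
      using shifted_commutator[of k b i d j] shifted_commutator[of k b j d i]
      by (auto simp: s_def shifted_Suc right_diff_distrib)
  qed (simp_all add: s_def)
  then have "(\<Sum>a\<in>UNIV. \<Sum>c\<in>UNIV. gen a * gen c * cst (s a c)) = 0"
    by (rule alternating_sum_symmetric)
  then have "eta k i * eta (Suc k) j + eta k j * eta (Suc k) i = 0"
    by (simp add: eta_def linear_form_mult s_def cst_add distrib_left sum.distrib)
  then show ?thesis by (simp add: eq_neg_iff_add_eq_0)
qed

lemma eta_repeat: "eta k i * eta (Suc k) i = 0"
  by (rule ext_double_zero) (use eta_swap[of k i i] in \<open>simp add: eq_neg_iff_add_eq_0\<close>)

text \<open>A unit of shift is worth one generator. This is used together with \<open>D_omega\<close>, where the same
  generator appears as a commutator.\<close>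

lemma eta_Suc: "eta (Suc k) j = eta k j - gen (Some j)"
proof -
  have "eta (Suc k) j = linear_form (\<lambda>i. case_option 0 (\<lambda>i. shifted k i j) i - (if i = Some j then 1 else 0))"
    unfolding eta_def
    by (rule arg_cong[where f = linear_form]) (auto simp: fun_eq_iff shifted_Suc split: option.splits)
  then show ?thesis by (simp add: linear_form_diff linear_form_unit eta_def)
qed

lemma gen_linear_form_anticommute: "gen i * linear_form a = - (linear_form a * gen i)"
  by (subst (1 2) linear_form_unit[symmetric], rule linear_form_anticommute) simp

lemma shifted_commute:
  assumes "\<And>i j. r * E i j = E i j * r" "r * T = T * r"
  shows "r * shifted k i j = shifted k i j * r"
  by (simp add: shifted_def left_diff_distrib right_diff_distrib distrib_left distrib_right assms
      mult_of_nat_commute)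

lemma eta_commute:
  assumes "\<And>i j. r * E i j = E i j * r" "r * T = T * r"
  shows "cst r * eta k j = eta k j * cst r"
  unfolding eta_def linear_form_cst_mult[symmetric] linear_form_mult_cst[symmetric]
  by (rule arg_cong[where f = linear_form])
    (auto simp: fun_eq_iff shifted_commute[OF assms] split: option.splits)

lemma omega_eta: "eta k j * omega = - (omega * eta k j)"
  unfolding eta_def omega_def
  by (rule linear_form_anticommute)
    (auto simp: shifted_commute[OF x_E x_T] split: option.splits)

lemma omega_square: "omega * omega = 0"
  unfolding omega_def by (rule linear_form_square) (auto simp: x_x split: option.splits)

lemma D_omega: "cst (D j) * omega = omega * cst (D j) + gen (Some j)"
proof -
  have "cst (D j) * omega = linear_form (\<lambda>i. case_option 1 x i * D j + (if i = Some j then 1 else 0))"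
    unfolding omega_def linear_form_cst_mult[symmetric]
    by (rule arg_cong[where f = linear_form]) (auto simp: fun_eq_iff D_x split: option.splits)
  then show ?thesis by (simp add: linear_form_add linear_form_unit linear_form_mult_cst omega_def)
qed

lemma D0_omega: "cst D0 * omega = omega * cst D0 - omega + gen None"
proof -
  have "cst D0 * omega = linear_form (\<lambda>i. case_option 1 x i * D0 - case_option 1 x i + (if i = None then 1 else 0))"
    unfolding omega_def linear_form_cst_mult[symmetric]
    by (rule arg_cong[where f = linear_form]) (auto simp: fun_eq_iff D0_x split: option.splits)
  then show ?thesis
    by (simp only: linear_form_add linear_form_diff linear_form_unit linear_form_mult_cst omega_def)
qed

lemma cst_omega_commute: "(\<And>i. r * x i = x i * r) \<Longrightarrow> cst r * omega = omega * cst r"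
  unfolding omega_def linear_form_cst_mult[symmetric] linear_form_mult_cst[symmetric]
  by (rule arg_cong[where f = linear_form]) (auto simp: fun_eq_iff split: option.splits)

text \<open>Products of columns with shifts increasing by one from \<open>k\<close>. The second function is the
  coefficient of \<open>omega\<close> in the third, as \<open>perturbed_eq\<close> shows; unfolded, it is the alternating sum
  over the positions \<open>b\<close> in the list of the products of the other columns, times \<open>D\<close> at \<open>b\<close>, where
  the columns before \<open>b\<close> have their shift raised by one, so that the shifts of the remaining columns
  are consecutive.\<close>

primrec etas :: "nat \<Rightarrow> 'n list \<Rightarrow> ('n option, 'a) ext" where
  "etas k [] = 1"
| "etas k (j # js) = eta k j * etas (Suc k) js"

primrec omega_part :: "nat \<Rightarrow> 'n list \<Rightarrow> ('n option, 'a) ext" where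
  "omega_part k [] = 0"
| "omega_part k (j # js) = etas (Suc k) js * cst (D j) - eta (Suc k) j * omega_part (Suc k) js"

primrec perturbed :: "nat \<Rightarrow> 'n list \<Rightarrow> ('n option, 'a) ext" where
  "perturbed k [] = 1"
| "perturbed k (j # js) = (omega * cst (D j) + eta k j) * perturbed (Suc k) js"

lemma etas_commute:
  assumes "\<And>i j. r * E i j = E i j * r" "r * T = T * r"
  shows "cst r * etas k js = etas k js * cst r"
proof (induction js arbitrary: k)
  case (Cons j js)
  have "cst r * (eta k j * y) = eta k j * (cst r * y)" for y
    by (simp only: mult.assoc[symmetric] eta_commute[OF assms])
  then show ?case by (simp add: Cons mult.assoc)
qed simp

text \<open>All occurrences of \<open>omega\<close> are moved to the left. Quadratic terms in \<open>omega\<close> vanish; the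
  commutator of \<open>omega\<close> with the \<open>D\<close> of the first column is a generator, which raises the shift of
  that column in the remaining linear term.\<close>

lemma perturbed_eq: "perturbed k js = etas k js + omega * omega_part k js"
proof (induction js arbitrary: k)
  case (Cons j js)
  define H L where "H = etas (Suc k) js" and "L = omega_part (Suc k) js"
  have "omega * cst (D j) * (omega * L) = omega * (cst (D j) * omega) * L"
    by (simp only: mult.assoc)
  also have "\<dots> = omega * omega * (cst (D j) * L) + omega * (gen (Some j) * L)"
    by (simp add: D_omega distrib_left distrib_right mult.assoc)
  finally have 1: "omega * cst (D j) * (omega * L) = omega * (gen (Some j) * L)"
    by (simp add: omega_square)
  have 2: "omega * cst (D j) * H = omega * (H * cst (D j))"
    by (simp add: H_def etas_commute[OF D_E D_T] mult.assoc)
  have "eta k j * (omega * L) = (eta k j * omega) * L"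
    by (simp only: mult.assoc)
  then have 3: "eta k j * (omega * L) = - (omega * (eta k j * L))"
    by (simp add: omega_eta mult.assoc)
  have "perturbed k (j # js) = (omega * cst (D j) + eta k j) * (H + omega * L)"
    by (simp add: Cons H_def L_def)
  also have "\<dots> = eta k j * H + omega * (H * cst (D j) - (eta k j - gen (Some j)) * L)"
    by (simp add: distrib_left distrib_right 1 2 3 left_diff_distrib right_diff_distrib)
  finally show ?case by (simp add: H_def L_def eta_Suc)
qed simp

text \<open>The column \<open>i\<close> is moved to the right by \<open>eta_swap\<close> until it meets its copy, where
  \<open>eta_repeat\<close> applies.\<close>

lemma eta_etas_member: "i \<in> set js \<Longrightarrow> eta k i * etas (Suc k) js = 0"
proof (induction js arbitrary: k)
  case (Cons j js)
  show ?case
  proof (cases "i = j")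
    case True
    then show ?thesis by (simp add: mult.assoc[symmetric] eta_repeat)
  next
    case False
    have "eta k i * (eta (Suc k) j * y) = - (eta k j * (eta (Suc k) i * y))" for y
      by (simp add: mult.assoc[symmetric] eta_swap[of k i j])
    then show ?thesis using False Cons by simp
  qed
qed simp

text \<open>A Laplace expansion: in the alternating sum, the summands that omit a column other than \<open>i\<close>
  vanish because column \<open>i\<close> is then repeated, and in the summand that omits \<open>i\<close> the new column
  moves to the gap, where the signs cancel.\<close>

lemma eta_omega_part:
  "i \<in> set js \<Longrightarrow> distinct js \<Longrightarrow> eta k i * omega_part k js = etas k js * cst (D i)"
proof (induction js arbitrary: k)
  case (Cons j js)
  show ?case
  proof (cases "i = j")
    case True
    then show ?thesis
      by (simp add: right_diff_distrib mult.assoc[symmetric] eta_repeat)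
  next
    case False
    have "eta k i * (eta (Suc k) j * y) = - (eta k j * (eta (Suc k) i * y))" for y
      by (simp add: mult.assoc[symmetric] eta_swap[of k i j])
    then show ?thesis
      using False Cons by (simp add: right_diff_distrib mult.assoc)
        (simp add: mult.assoc[symmetric] eta_etas_member)
  qed
qed simp

lemma killed_by_etas: "length js + m = Suc (card (UNIV :: 'n set)) \<Longrightarrow> killed_by m (etas k js)"
proof (induction js arbitrary: k m)
  case Nil
  then show ?case using killed_by_Suc_card by simp
next
  case (Cons j js)
  then show ?case by (simp add: eta_def killed_by_linear_form_mult)
qed

lemma killed_by_omega_part:
  "length js + m = Suc (Suc (card (UNIV :: 'n set))) \<Longrightarrow> killed_by m (omega_part k js)"
proof (induction js arbitrary: k m)
  case Nil
  then show ?case by (simp add: killed_by_def)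
next
  case (Cons j js)
  then have "killed_by m (etas (Suc k) js)" "killed_by (Suc m) (omega_part (Suc k) js)"
    by (simp_all add: killed_by_etas)
  then show ?case
    unfolding omega_part.simps eta_def
    by (intro killed_by_diff killed_by_mult_right killed_by_linear_form_mult) simp_all
qed

text \<open>The first factor is the column with index \<open>0\<close>. With \<open>H\<close>, \<open>L\<close> and \<open>w = omega - gen None\<close> as in
  the proof, the terms \<open>w * H\<close>, \<open>eta 0 i * H\<close> and \<open>w * (eta 0 i * L)\<close> vanish. The two surviving
  contributions of \<open>L\<close> are both multiples of \<open>gen None\<close> and combine, by \<open>eta_Suc\<close>, to
  \<open>eta 1 i * L\<close>, to which the Laplace expansion applies.\<close>

lemma bordered_columns_product:
  assumes js: "set js = UNIV" "distinct js"
  shows "(omega * cst (D0 - T) - (\<Sum>i\<in>UNIV. cst (x i) * eta 0 i)) * perturbed 1 js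
     = cst (D0 + (\<Sum>i\<in>UNIV. x i * D i) - T) * (gen None * etas 1 js)"
proof -
  define H L where "H = etas 1 js" and "L = omega_part 1 js"
  define w where "w = linear_form (case_option 0 x)"
  have omega: "omega = gen None + w"
  proof -
    have "omega = linear_form (\<lambda>i. (if i = None then 1 else 0) + case_option 0 x i)"
      unfolding omega_def
      by (rule arg_cong[where f = linear_form]) (auto simp: fun_eq_iff split: option.splits)
    then show ?thesis by (simp add: linear_form_add linear_form_unit w_def)
  qed
  have len: "length js = card (UNIV :: 'n set)"
    using js by (metis distinct_card)
  have wH: "w * H = 0"
  proof -
    have "killed_by (Suc 0) H" unfolding H_def by (rule killed_by_etas) (simp add: len)
    then have "killed_by 0 (w * H)" unfolding w_def by (rule killed_by_linear_form_mult) simp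
    then show ?thesis by (simp add: killed_by_0)
  qed
  have weL: "w * (eta 0 i * L) = 0" for i
  proof -
    have "killed_by (Suc (Suc 0)) L" unfolding L_def by (rule killed_by_omega_part) (simp add: len)
    then have "killed_by 0 (w * (eta 0 i * L))"
      unfolding w_def eta_def by (intro killed_by_linear_form_mult) simp_all
    then show ?thesis by (simp add: killed_by_0)
  qed
  have gg: "gen None * (gen None * y) = 0" for y :: "('n option, 'a) ext"
    by (simp add: mult.assoc[symmetric] gen_square)
  have xg: "cst r * (gen k * y) = gen k * (cst r * y)" for r k and y :: "('n option, 'a) ext"
    by (simp add: mult.assoc[symmetric] cst_gen_commute)

  have "(D0 - T) * E i j = E i j * (D0 - T)" for i j
    by (simp add: left_diff_distrib right_diff_distrib D0_E T_E)
  moreover have "(D0 - T) * T = T * (D0 - T)"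
    by (simp add: left_diff_distrib right_diff_distrib D0_T)
  ultimately have A: "omega * (cst (D0 - T) * H) = cst (D0 - T) * (gen None * H)"
    by (simp add: H_def[symmetric] etas_commute[of "D0 - T" 1 js, folded H_def] omega distrib_right
        mult.assoc[symmetric] wH) (simp add: mult.assoc etas_commute[of "D0 - T" 1 js, folded H_def, symmetric] xg)

  \<comment> \<open>Multiplied by \<open>omega\<close> from the left, only the last summand survives.\<close>
  have DT: "cst (D0 - T) * omega = omega * cst (D0 - T) - omega + gen None"
    using D0_omega cst_omega_commute[of T] x_T
    by (simp add: cst_diff left_diff_distrib right_diff_distrib algebra_simps)
  have "omega * (cst (D0 - T) * (omega * L)) = omega * (cst (D0 - T) * omega) * L"
    by (simp only: mult.assoc)
  also have "\<dots> = omega * omega * (cst (D0 - T) * L) - omega * omega * L + omega * (gen None * L)"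
    by (simp add: DT distrib_left distrib_right left_diff_distrib right_diff_distrib mult.assoc)
  also have "\<dots> = w * (gen None * L)"
    by (simp add: omega_square) (simp add: omega distrib_right gg)
  also have "\<dots> = - (gen None * (w * L))"
    using gen_linear_form_anticommute[of None "case_option 0 x"]
    by (simp add: w_def mult.assoc[symmetric])
  also have "w * L = (\<Sum>i\<in>UNIV. cst (x i) * (gen (Some i) * L))"
    by (simp add: w_def linear_form_def sum_option sum_distrib_right cst_gen_commute mult.assoc[symmetric])
  finally have B: "omega * (cst (D0 - T) * (omega * L))
      = - (gen None * (\<Sum>i\<in>UNIV. cst (x i) * (gen (Some i) * L)))" .

  have C: "(\<Sum>i\<in>UNIV. cst (x i) * eta 0 i) * H = 0"
    using js by (simp add: sum_distrib_right mult.assoc H_def eta_etas_member)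

  have "cst (x i) * (eta 0 i * (omega * L)) = - (gen None * (cst (x i) * (eta 0 i * L)))" for i
  proof -
    have "eta 0 i * (omega * L) = - (omega * (eta 0 i * L))"
      by (simp add: mult.assoc[symmetric] omega_eta)
    then show ?thesis
      by (simp add: omega distrib_right weL xg)
  qed
  then have D: "(\<Sum>i\<in>UNIV. cst (x i) * eta 0 i) * (omega * L)
      = - (gen None * (\<Sum>i\<in>UNIV. cst (x i) * (eta 0 i * L)))"
    by (simp add: sum_distrib_right sum_distrib_left mult.assoc sum_negf)

  have "(\<Sum>i\<in>UNIV. cst (x i) * (eta 0 i * L)) - (\<Sum>i\<in>UNIV. cst (x i) * (gen (Some i) * L))
      = (\<Sum>i\<in>UNIV. cst (x i) * (eta 1 i * L))"
    by (simp add: sum_subtractf[symmetric] eta_Suc left_diff_distrib right_diff_distrib)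
  also have "\<dots> = (\<Sum>i\<in>UNIV. cst (x i * D i)) * H"
    using js
    by (simp add: L_def eta_omega_part H_def sum_distrib_right cst_mult mult.assoc etas_commute[OF D_E D_T])
  finally have F: "(\<Sum>i\<in>UNIV. cst (x i) * (eta 0 i * L)) - (\<Sum>i\<in>UNIV. cst (x i) * (gen (Some i) * L))
      = cst (\<Sum>i\<in>UNIV. x i * D i) * H"
    by (simp add: cst_sum)

  have "perturbed 1 js = H + omega * L"
    by (simp add: perturbed_eq H_def L_def)
  then have "(omega * cst (D0 - T) - (\<Sum>i\<in>UNIV. cst (x i) * eta 0 i)) * perturbed 1 js
      = omega * (cst (D0 - T) * H) + omega * (cst (D0 - T) * (omega * L))
        - (\<Sum>i\<in>UNIV. cst (x i) * eta 0 i) * H - (\<Sum>i\<in>UNIV. cst (x i) * eta 0 i) * (omega * L)"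
    by (simp add: left_diff_distrib right_diff_distrib distrib_left distrib_right mult.assoc)
  also have "\<dots> = cst (D0 - T) * (gen None * H) + gen None *
      ((\<Sum>i\<in>UNIV. cst (x i) * (eta 0 i * L)) - (\<Sum>i\<in>UNIV. cst (x i) * (gen (Some i) * L)))"
    by (simp only: A B C D right_diff_distrib) simp
  also have "\<dots> = cst (D0 + (\<Sum>i\<in>UNIV. x i * D i) - T) * (gen None * H)"
    unfolding F by (simp add: xg[symmetric] cst_add cst_diff left_diff_distrib right_diff_distrib distrib_right)
  finally show ?thesis by (simp add: H_def)
qed

definition bordered :: "'n option \<Rightarrow> 'n option \<Rightarrow> 'a" where
  "bordered a b = (case a of
      None \<Rightarrow> (case b of None \<Rightarrow> D0 - T | Some j \<Rightarrow> D j)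
    | Some i \<Rightarrow> (case b of None \<Rightarrow> x i * D0 - (\<Sum>k\<in>UNIV. x k * E i k)
        | Some j \<Rightarrow> x i * D j + shifted (Suc (index_pos i)) i j))"

theorem column_det_bordered:
  "column_det bordered = (D0 + (\<Sum>i\<in>UNIV. x i * D i) - T)
     * column_det (\<lambda>i j. shifted (Suc (index_pos i)) i j)"
proof -
  define L where "L = sorted_list_of_set (UNIV :: 'n set)"
  have L: "set L = UNIV" "distinct L" by (simp_all add: L_def)
  \<comment> \<open>The shift is prescribed by the row but only matters on the diagonal, so that it can be
    attached to the column, as the ordered product of columns requires.\<close>
  have shift: "shifted (Suc (index_pos i)) i j = shifted (Suc (index_pos j)) i j" for i j
    by (simp add: shifted_def)
  \<comment> \<open>The matrix whose columns are the factors of \<open>gen None * etas 1 L\<close>.\<close>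
  define B where "B a b = case_option (if a = None then 1 else 0)
    (\<lambda>j. case_option 0 (\<lambda>i. shifted (Suc (index_pos j)) i j) a) b" for a b :: "'n option"

  have pos: "map (\<lambda>j. Suc (index_pos j)) L = [1..<1 + length L]"
  proof -
    have "map (\<lambda>j. Suc (index_pos j)) L = map Suc (map index_pos L)" by simp
    also have "\<dots> = [1..<1 + length L]"
      unfolding L_def map_index_pos map_Suc_upt by simp
    finally show ?thesis .
  qed
  have prods: "etas k js = prod_list (map (\<lambda>j. eta (Suc (index_pos j)) j) js)
      \<and> perturbed k js = prod_list (map (\<lambda>j. omega * cst (D j) + eta (Suc (index_pos j)) j) js)"
    if "map (\<lambda>j. Suc (index_pos j)) js = [k..<k + length js]" for k js
    using that
  proof (induction js arbitrary: k)
    case (Cons j js)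
    then have "Suc (index_pos j) = k" "map (\<lambda>j. Suc (index_pos j)) js = [Suc k..<Suc k + length js]"
      by (simp_all add: upt_conv_Cons del: upt_Suc)
    with Cons.IH[of "Suc k"] show ?case by simp
  qed simp
  note etas = prods[THEN conjunct1] and perturbed = prods[THEN conjunct2]

  \<comment> \<open>In the column \<open>None\<close> the terms with \<open>T\<close> in \<open>omega\<close> and in the \<open>eta 0 i\<close> cancel in every
    row except the first.\<close>
  have "linear_form (\<lambda>i. bordered i None)
      = linear_form (\<lambda>i. case_option 1 x i * (D0 - T) - (\<Sum>k\<in>UNIV. x k * case_option 0 (\<lambda>i. shifted 0 i k) i))"
  proof (rule arg_cong[where f = linear_form], rule ext)
    fix a :: "'n option"
    show "bordered a None = case_option 1 x a * (D0 - T) - (\<Sum>k\<in>UNIV. x k * case_option 0 (\<lambda>i. shifted 0 i k) a)"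
    proof (cases a)
      case (Some i)
      have "x k * shifted 0 i k = x k * E i k - (if i = k then x k * T else 0)" for k
        by (simp add: shifted_def right_diff_distrib)
      then show ?thesis
        by (simp add: Some bordered_def sum_subtractf right_diff_distrib)
    qed (simp add: bordered_def)
  qed
  also have "\<dots> = omega * cst (D0 - T) - (\<Sum>i\<in>UNIV. cst (x i) * eta 0 i)"
    by (simp add: linear_form_diff linear_form_mult_cst linear_form_sum linear_form_cst_mult omega_def eta_def)
  finally have col0: "linear_form (\<lambda>i. bordered i None)
      = omega * cst (D0 - T) - (\<Sum>i\<in>UNIV. cst (x i) * eta 0 i)" .
  have col: "linear_form (\<lambda>i. bordered i (Some j)) = omega * cst (D j) + eta (Suc (index_pos j)) j" for j
  proof -
    have "linear_form (\<lambda>i. bordered i (Some j))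
        = linear_form (\<lambda>i. case_option 1 x i * D j + case_option 0 (\<lambda>i. shifted (Suc (index_pos j)) i j) i)"
      by (rule arg_cong[where f = linear_form])
        (auto simp: fun_eq_iff bordered_def intro: shift split: option.splits)
    then show ?thesis by (simp add: linear_form_add linear_form_mult_cst omega_def eta_def)
  qed
  have "column_det bordered
      = vol (prod_list (map (\<lambda>j. linear_form (\<lambda>i. bordered i j)) (sorted_list_of_set UNIV)))"
    by (rule vol_prod_linear_forms[symmetric])
  also have "\<dots> = vol ((omega * cst (D0 - T) - (\<Sum>i\<in>UNIV. cst (x i) * eta 0 i)) * perturbed 1 L)"
    unfolding perturbed[OF pos] by (simp add: sorted_list_option col0 col o_def flip: L_def)
  also have "\<dots> = (D0 + (\<Sum>i\<in>UNIV. x i * D i) - T) * vol (gen None * etas 1 L)"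
    unfolding bordered_columns_product[OF L] by (rule vol_cst_mult)
  also have "gen None * etas 1 L = prod_list (map (\<lambda>j. linear_form (\<lambda>i. B i j)) (sorted_list_of_set UNIV))"
    unfolding etas[OF pos]
    by (simp add: sorted_list_option B_def linear_form_unit eta_def o_def flip: L_def)
  also have "vol \<dots> = column_det (\<lambda>i j. B (Some i) (Some j))"
    by (subst vol_prod_linear_forms, rule column_det_block) (simp_all add: B_def)
  also have "(\<lambda>i j. B (Some i) (Some j)) = (\<lambda>i j. shifted (Suc (index_pos i)) i j)"
    by (auto simp: fun_eq_iff B_def intro: shift[symmetric])
  finally show ?thesis .
qed

end

section \<open>Substitution and evaluation of polynomials\<close>

locale unital_ring_hom =
  fixes f :: "'a::ring_1 \<Rightarrow> 'b::ring_1"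
  assumes hom_add: "f (u + v) = f u + f v"
    and hom_mult: "f (u * v) = f u * f v"
    and hom_one: "f 1 = 1"
begin

lemma hom_zero: "f 0 = 0"
  by (metis add_cancel_right_left hom_add)

lemma hom_minus: "f (- u) = - f u"
  by (metis add.right_inverse hom_add hom_zero minus_unique)

lemma hom_diff: "f (u - v) = f u - f v"
  by (metis diff_conv_add_uminus hom_add hom_minus)

lemma hom_of_nat: "f (of_nat n) = of_nat n"
  by (induction n) (simp_all add: hom_zero hom_add hom_one)

lemma hom_of_int: "f (of_int z) = of_int z"
  by (cases z) (simp_all add: hom_of_nat hom_minus hom_diff hom_one)

lemma hom_sum: "f (sum g S) = (\<Sum>s\<in>S. f (g s))"
  by (induction S rule: infinite_finite_induct) (simp_all add: hom_zero hom_add)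

lemma hom_prod_list: "f (prod_list us) = prod_list (map f us)"
  by (induction us) (simp_all add: hom_one hom_mult)

lemma hom_column_det: "f (column_det A) = column_det (\<lambda>i j. f (A i j))"
  by (simp add: column_det_def hom_sum hom_mult hom_of_int hom_prod_list o_def)

lemma map_hom_add: "Poly_Mapping.map f (p + q) = Poly_Mapping.map f p + Poly_Mapping.map f q"
  by (rule poly_mapping_eqI) (simp add: map.rep_eq lookup_add when_def hom_add hom_zero flip: hom_add)

lemma map_hom_single: "Poly_Mapping.map f (Poly_Mapping.single k c) = Poly_Mapping.single k (f c)"
  by (rule poly_mapping_eqI) (simp add: map.rep_eq lookup_single when_def hom_zero)

end

lemma pconst_zero [simp]: "pconst 0 = 0"
  by (simp add: pconst_def)

lemma pconst_one [simp]: "pconst 1 = 1"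
  by (simp add: pconst_def)

lemma pconst_add: "pconst (a + b) = pconst a + pconst b"
  by (simp add: pconst_def single_add)

lemma pconst_diff: "pconst (a - b) = pconst a - pconst b"
  by (simp add: pconst_def single_diff)

lemma pconst_mult: "pconst (a * b) = pconst a * pconst b"
  by (simp add: pconst_def mult_single)

lemma pconst_sum: "pconst (sum f S) = (\<Sum>s\<in>S. pconst (f s))"
  by (induction S rule: infinite_finite_induct) (simp_all add: pconst_add)

lemma pvar_commute: "pvar * p = p * pvar"
  by (induction p rule: poly_mapping_single_induct)
    (simp_all add: pvar_def distrib_left distrib_right mult_single add.commute)

lemma psubst_superset:
  assumes "finite S" "Poly_Mapping.keys p \<subseteq> S"
  shows "psubst p q = (\<Sum>k\<in>S. pconst (Poly_Mapping.lookup p k) * q ^ k)"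
  unfolding psubst_def using assms by (intro sum.mono_neutral_left) (auto simp: in_keys_iff)

lemma psubst_add: "psubst (p + p') q = psubst p q + psubst p' q"
proof -
  have "Poly_Mapping.keys (p + p') \<subseteq> Poly_Mapping.keys p \<union> Poly_Mapping.keys p'" by (rule keys_add)
  then show ?thesis
    by (simp add: psubst_superset[of "Poly_Mapping.keys p \<union> Poly_Mapping.keys p'"] lookup_add
        pconst_add distrib_right sum.distrib)
qed

lemma psubst_single: "psubst (Poly_Mapping.single k c) q = pconst c * q ^ k"
  by (cases "c = 0") (simp_all add: psubst_def)

lemma power_commute:
  assumes "a * q = q * (a :: 'a::monoid_mult)"
  shows "a * q ^ k = q ^ k * a"
  by (induction k) (simp_all, metis assms mult.assoc)

text \<open>Over a noncommutative ring substitution is multiplicative only if the argument commutes with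
  the coefficients. Here this is required for the image of \<open>f\<close> alone, so that it can be applied to
  an argument that is central only relative to this image.\<close>

lemma unital_ring_hom_psubst_map:
  assumes "unital_ring_hom f" and commute: "\<And>u. pconst (f u) * q = q * pconst (f u)"
  shows "unital_ring_hom (\<lambda>p. psubst (Poly_Mapping.map f p) q)"
proof -
  interpret f: unital_ring_hom f by fact
  show ?thesis
  proof
    show add: "psubst (Poly_Mapping.map f (u + v)) q
        = psubst (Poly_Mapping.map f u) q + psubst (Poly_Mapping.map f v) q" for u v
      by (simp add: f.map_hom_add psubst_add)
    show "psubst (Poly_Mapping.map f 1) q = 1"
      using f.map_hom_single[of "0 :: nat" 1] psubst_single[of 0 1 q] by (simp add: f.hom_one)
    fix u v :: "'a npoly"
    show "psubst (Poly_Mapping.map f (u * v)) q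
        = psubst (Poly_Mapping.map f u) q * psubst (Poly_Mapping.map f v) q"
    proof (induction u rule: poly_mapping_single_induct)
      case (single k c)
      show ?case
      proof (induction v rule: poly_mapping_single_induct)
        case (single l d)
        have "pconst (f c) * (pconst (f d) * q ^ k) * q ^ l = pconst (f c) * (q ^ k * pconst (f d)) * q ^ l"
          by (simp only: power_commute[OF commute])
        then show ?case
          by (simp add: mult_single f.map_hom_single psubst_single f.hom_mult pconst_mult power_add mult.assoc)
      qed (simp add: distrib_left add)
    qed (simp add: distrib_right add)
  qed
qed

lemma unital_ring_hom_map:
  assumes "unital_ring_hom f"
  shows "unital_ring_hom (Poly_Mapping.map f :: 'a::ring_1 npoly \<Rightarrow> 'b::ring_1 npoly)"
proof -
  interpret f: unital_ring_hom f by fact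
  show ?thesis
  proof
    show add: "Poly_Mapping.map f (u + v) = Poly_Mapping.map f u + Poly_Mapping.map f v" for u v :: "'a npoly"
      by (rule f.map_hom_add)
    show "Poly_Mapping.map f (1 :: 'a npoly) = 1"
      using f.map_hom_single[of "0 :: nat" 1] by (simp add: f.hom_one)
    fix u v :: "'a npoly"
    show "Poly_Mapping.map f (u * v) = Poly_Mapping.map f u * Poly_Mapping.map f v"
    proof (induction u rule: poly_mapping_single_induct)
      case (single k c)
      show ?case
        by (induction v rule: poly_mapping_single_induct)
          (simp_all add: distrib_left add mult_single f.map_hom_single f.hom_mult)
    qed (simp add: distrib_right add)
  qed
qed

lemma peval_superset:
  assumes "finite S" "Poly_Mapping.keys p \<subseteq> S"
  shows "peval p x = (\<Sum>k\<in>S. Poly_Mapping.lookup p k * x ^ k)"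
  unfolding peval_def using assms by (intro sum.mono_neutral_left) (auto simp: in_keys_iff)

lemma peval_add: "peval (p + q) x = peval p x + peval q x"
proof -
  have "Poly_Mapping.keys (p + q) \<subseteq> Poly_Mapping.keys p \<union> Poly_Mapping.keys q" by (rule keys_add)
  then show ?thesis
    by (simp add: peval_superset[of "Poly_Mapping.keys p \<union> Poly_Mapping.keys q"] lookup_add
        distrib_right sum.distrib)
qed

lemma peval_single: "peval (Poly_Mapping.single k c) x = c * x ^ k"
  by (cases "c = 0") (simp_all add: peval_def)

lemma peval_mult_pvar: "peval (p * pvar) x = peval p x * x"
  by (induction p rule: poly_mapping_single_induct)
    (simp_all add: distrib_right peval_add peval_single pvar_def mult_single power_commutes mult.assoc)

lemma peval_mult_pconst:
  assumes "r * x = x * r"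
  shows "peval (p * pconst r) x = peval p x * r"
  by (induction p rule: poly_mapping_single_induct)
    (simp_all add: distrib_right peval_add peval_single pconst_def mult_single mult.assoc
      power_commute[OF assms])

text \<open>Both evaluations keep the coefficients of \<open>p\<close> on the left; only \<open>x\<close> and \<open>r\<close> change
  places.\<close>

lemma peval_psubst_shift:
  assumes "r * x = x * r"
  shows "peval (psubst p (pvar + pconst r)) x = peval p (x + r)"
proof (induction p rule: poly_mapping_single_induct)
  case (single k c)
  have "peval (pconst c * (pvar + pconst r) ^ k) x = c * (x + r) ^ k"
  proof (induction k)
    case 0
    show ?case using peval_single[of 0 c x] by (simp add: pconst_def)
  next
    case (Suc k)
    have "peval (pconst c * (pvar + pconst r) ^ Suc k) x
        = peval (pconst c * (pvar + pconst r) ^ k * pvar + pconst c * (pvar + pconst r) ^ k * pconst r) x"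
      by (simp only: power_Suc2 distrib_left mult.assoc)
    also have "\<dots> = c * (x + r) ^ k * (x + r)"
      by (simp add: peval_add peval_mult_pvar peval_mult_pconst[OF assms] Suc distrib_left)
    finally show ?case by (simp only: power_Suc2 mult.assoc)
  qed
  then show ?case by (simp add: psubst_single peval_single)
qed (simp add: psubst_add peval_add)

lemma peval_root_factor:
  assumes "\<And>k. Poly_Mapping.lookup p k * x = x * Poly_Mapping.lookup p k"
  shows "peval ((pconst x - pvar) * p) x = 0"
proof -
  have "pconst x * p = p * pconst x"
  proof -
    have "pconst x * Poly_Mapping.single k (Poly_Mapping.lookup p k)
        = Poly_Mapping.single k (Poly_Mapping.lookup p k) * pconst x" for k
      by (simp add: pconst_def mult_single assms)
    then show ?thesis
      by (subst (1 2) poly_mapping_expand[of p]) (simp only: sum_distrib_left sum_distrib_right)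
  qed
  then have "(pconst x - pvar) * p + p * pvar = p * pconst x"
    by (simp add: left_diff_distrib pvar_commute)
  then have "peval ((pconst x - pvar) * p) x + peval (p * pvar) x = peval (p * pconst x) x"
    by (simp flip: peval_add)
  then show ?thesis by (simp add: peval_mult_pvar peval_mult_pconst)
qed

section \<open>The Capelli determinant under the homomorphism\<close>

lemma ugl_induct [case_names one Egl add scaleC]:
  assumes one: "P 1" and Egl: "\<And>i j u. P u \<Longrightarrow> P (Egl i j * u)"
    and add: "\<And>u v. P u \<Longrightarrow> P v \<Longrightarrow> P (u + v)" and scaleC: "\<And>c u. P u \<Longrightarrow> P (c *\<^sub>C u)"
  shows "P (u :: 'i ugl)"
proof -
  have word: "P (abs_ugl (Poly_Mapping.single (Word w) 1))" for w :: "('i \<times> 'i) list"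
  proof (induction w)
    case Nil
    then show ?case using one by (simp add: one_ugl_def flip: single_one zero_word_def)
  next
    case (Cons g w)
    obtain a b where g: "g = (a, b)" by (cases g)
    have "Poly_Mapping.single (Word (g # w)) 1 = freegen g * (Poly_Mapping.single (Word w) 1 :: _ \<Rightarrow>\<^sub>0 complex)"
      by (simp add: freegen_def mult_single)
    then have "abs_ugl (Poly_Mapping.single (Word (g # w)) 1) = Egl a b * abs_ugl (Poly_Mapping.single (Word w) 1)"
      by (simp add: g Egl.abs_eq times_ugl.abs_eq)
    then show ?case using Egl Cons by simp
  qed
  have "P (abs_ugl x)" for x :: "('i \<times> 'i) word \<Rightarrow>\<^sub>0 complex"
  proof (induction x rule: poly_mapping_single_induct)
    case (add p q)
    then show ?case using assms(3) by (simp flip: plus_ugl.abs_eq)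
  next
    case (single k c)
    obtain w where "k = Word w" by (cases k)
    then have "Poly_Mapping.single k c = c *\<^sub>C Poly_Mapping.single (Word w) (1 :: complex)"
      by (simp add: scaleC_single scaleC_complex_def)
    then show ?case using scaleC[OF word] by (simp flip: scaleC_ugl.abs_eq)
  qed
  then show ?thesis by (metis Quotient3_abs_rep[OF Quotient3_ugl])
qed

text \<open>What is needed of the centrality of \<open>R1\<close>: it makes the substitution of \<open>pvar + pconst R1\<close>
  into polynomials with coefficients in the image of \<open>rho\<close> a homomorphism.\<close>

lemma R1_rho_commute: "R1 * rho u = rho u * R1"
proof (induction u rule: ugl_induct)
  case (Egl a b u)
  have "comm R1 (rho_gen a b) = 0"
    by (cases a; cases b)
      (simp_all add: comm_add_right comm_diff_right comm_R1 comm_R1_tE_sum flip: tE_sum_def)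
  then have R1_gen: "R1 * rho_gen a b = rho_gen a b * R1" by (simp add: comm_def)
  have "R1 * rho (Egl a b * u) = (R1 * rho_gen a b) * rho u"
    by (simp add: rho_mult rho_Egl mult.assoc)
  also have "\<dots> = rho_gen a b * (R1 * rho u)"
    by (simp only: R1_gen mult.assoc)
  also have "\<dots> = rho (Egl a b * u) * R1"
    by (simp only: Egl rho_mult rho_Egl mult.assoc)
  finally show ?case .
qed (simp_all add: rho_one rho_add rho_scaleC distrib_left distrib_right mult_scaleC_left mult_scaleC_right)

lemma unital_ring_hom_rho: "unital_ring_hom rho"
  by standard (rule rho_add rho_mult rho_one)+

lemma unital_ring_hom_right_factor: "unital_ring_hom (\<lambda>u. 1 \<otimes> u)"
  by standard (simp_all add: tens_add_right tens_mult tens_one)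

lemma map_ident: "Poly_Mapping.map (\<lambda>u. u) p = p"
  by (rule poly_mapping_eqI) (simp add: map.rep_eq when_def)

lemma psubst_C_rho:
  "psubst (C_rho :: ('n::{finite,linorder} dprime, 'n ugl) tensor npoly) (pvar + pconst R1)
     = column_det (\<lambda>i j. pconst (rho_gen i j) - (if i = j then pvar + pconst R1 + of_nat (index_pos i) else 0))"
proof -
  have commute: "pconst (rho u) * (pvar + pconst R1) = (pvar + pconst R1) * pconst (rho u)"
    for u :: "'n option ugl"
    by (simp add: distrib_left distrib_right pvar_commute R1_rho_commute flip: pconst_mult)
  interpret h: unital_ring_hom "\<lambda>p. psubst (Poly_Mapping.map rho p) (pvar + pconst (R1 :: ('n dprime, 'n ugl) tensor))"
    by (rule unital_ring_hom_psubst_map[OF unital_ring_hom_rho commute])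
  interpret rho: unital_ring_hom rho by (rule unital_ring_hom_rho)
  have "psubst (Poly_Mapping.map rho (pconst u)) (pvar + pconst R1) = pconst (rho u)" for u :: "'n option ugl"
    by (simp add: pconst_def[of u] rho.map_hom_single psubst_single)
  moreover have "psubst (Poly_Mapping.map rho pvar) (pvar + pconst R1) = pvar + pconst (R1 :: ('n dprime, 'n ugl) tensor)"
    by (simp add: pvar_def[where 'a = "'n option ugl"] rho.map_hom_single psubst_single rho_one)
  ultimately have "psubst (Poly_Mapping.map rho
        (pconst (Egl i j) - (if i = j then pvar + of_nat (index_pos i) else 0))) (pvar + pconst R1)
      = pconst (rho_gen i j) - (if i = j then pvar + pconst R1 + of_nat (index_pos i) else 0)" for i j :: "'n option"
    by (simp add: h.hom_zero h.hom_diff h.hom_add h.hom_of_nat rho_Egl)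
  then show ?thesis
    unfolding C_rho_def capelli_def h.hom_column_det by simp
qed

text \<open>The substitution of \<open>T + 1\<close> turns the shifts \<open>i - 1\<close> of the small Capelli determinant into the
  shifts \<open>i\<close> that the rows \<open>1, \<dots>, n\<close> have in the large one.\<close>

lemma map_psubst_capelli:
  "Poly_Mapping.map (\<lambda>u. 1 \<otimes> u) (psubst capelli (pvar + 1))
     = (column_det (\<lambda>i j. pconst (1 \<otimes> Egl i j) - (if i = j then pvar + of_nat (Suc (index_pos i)) else 0))
        :: ('n::{finite,linorder} dprime, 'n ugl) tensor npoly)"
proof -
  let ?t = "(\<lambda>u. 1 \<otimes> u) :: 'n ugl \<Rightarrow> ('n dprime, 'n ugl) tensor"
  have id: "unital_ring_hom (\<lambda>u. u :: 'n ugl)" by standard simp_all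
  have commute: "pconst u * (pvar + 1) = (pvar + 1) * pconst u" for u :: "'n ugl"
    by (simp add: distrib_left distrib_right pvar_commute)
  interpret t: unital_ring_hom ?t by (rule unital_ring_hom_right_factor)
  interpret m: unital_ring_hom "Poly_Mapping.map ?t :: 'n ugl npoly \<Rightarrow> _"
    by (rule unital_ring_hom_map[OF unital_ring_hom_right_factor])
  interpret s: unital_ring_hom "\<lambda>p. psubst p (pvar + 1 :: 'n ugl npoly)"
    using unital_ring_hom_psubst_map[OF id commute] by (simp add: map_ident)
  have c: "Poly_Mapping.map ?t (pconst u) = pconst (?t u)" for u
    by (simp add: pconst_def t.map_hom_single)
  have v: "Poly_Mapping.map ?t pvar = pvar"
    by (simp add: pvar_def t.map_hom_single tens_one)
  have sc: "psubst (pconst u) (pvar + 1) = pconst u" for u :: "'n ugl"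
    by (simp add: pconst_def[of u] psubst_single)
  have sv: "psubst pvar (pvar + 1 :: 'n ugl npoly) = pvar + 1"
    by (simp add: pvar_def[where 'a = "'n ugl"] psubst_single)
  have "Poly_Mapping.map ?t (psubst (pconst (Egl i j) - (if i = j then pvar + of_nat (index_pos i) else 0)) (pvar + 1))
      = pconst (?t (Egl i j)) - (if i = j then pvar + of_nat (Suc (index_pos i)) else 0)" for i j :: 'n
    by (simp add: s.hom_zero m.hom_zero s.hom_diff m.hom_diff s.hom_add m.hom_add s.hom_of_nat m.hom_of_nat m.hom_one c v sc sv add.assoc)
  then show ?thesis
    unfolding capelli_def s.hom_column_det m.hom_column_det by simp
qed

interpretation capelli_rho: gl_weyl
  "\<lambda>i j. pconst (1 \<otimes> Egl i j) :: ('n::{finite,linorder} dprime, 'n ugl) tensor npoly"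
  "\<lambda>i. pconst (tratio i \<otimes> 1)" "\<lambda>i. pconst (tdel None (Some i) \<otimes> 1)"
  "pconst (tdel None None \<otimes> 1)" pvar
proof
  fix i j k l :: 'n
  show "pconst (1 \<otimes> Egl i j) * pconst (1 \<otimes> Egl k l) - pconst (1 \<otimes> Egl k l) * pconst (1 \<otimes> Egl i j)
      = (if j = k then pconst (1 \<otimes> Egl i l) else 0) - (if l = i then pconst (1 \<otimes> Egl k j) else 0
        :: ('n dprime, 'n ugl) tensor npoly)"
    using arg_cong[OF Egl_commutator[of i j k l], of "\<lambda>u. pconst (1 \<otimes> u) :: ('n dprime, 'n ugl) tensor npoly"]
    unfolding tens_diff_right pconst_diff
    by (simp add: tens_mult if_distrib[where f = "\<lambda>u. pconst (1 \<otimes> u)"] flip: pconst_mult cong: if_cong)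
  have "tdel None (Some j) * tratio i = tratio i * tdel None (Some j) + (if i = j then 1 else 0)"
    using tdel_tratio_commutator[of None "Some j" i] by (simp add: algebra_simps split: if_splits)
  then show "pconst (tdel None (Some j) \<otimes> 1) * pconst (tratio i \<otimes> 1)
      = pconst (tratio i \<otimes> 1) * pconst (tdel None (Some j) \<otimes> 1)
        + (if i = j then 1 else 0 :: ('n dprime, 'n ugl) tensor npoly)"
    by (simp add: tens_mult tens_add_left pconst_add tens_one flip: pconst_mult)
  have "tdel None None * tratio i = tratio i * tdel None None - tratio i"
    using tdel_tratio_commutator[of None None i] by (simp add: algebra_simps)
  then show "pconst (tdel None None \<otimes> 1) * pconst (tratio i \<otimes> 1)
      = pconst (tratio i \<otimes> 1) * pconst (tdel None None \<otimes> 1) - (pconst (tratio i \<otimes> 1) :: ('n dprime, 'n ugl) tensor npoly)"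
    by (simp add: tens_mult tens_diff_left pconst_diff flip: pconst_mult)
qed (simp_all add: tens_mult pvar_commute tratio_commute flip: pconst_mult)

theorem theorem5p1:
  shows "psubst (C_rho :: ('n::{finite,linorder} dprime, 'n ugl) tensor npoly) (pvar + pconst R1)
           = (pconst (euler \<otimes> 1) - pvar) * Poly_Mapping.map (\<lambda>u. 1 \<otimes> u) (psubst capelli (pvar + 1))
         \<and> peval (C_rho :: ('n dprime, 'n ugl) tensor npoly) (euler \<otimes> 1 + R1) = 0"
proof
  let ?C = "Poly_Mapping.map (\<lambda>u. 1 \<otimes> u) (psubst capelli (pvar + 1)) :: ('n dprime, 'n ugl) tensor npoly"
  \<comment> \<open>The substitution cancels the \<open>R1\<close> in the diagonal entries.\<close>
  have entries: "pconst (rho_gen a b) - (if a = b then pvar + pconst R1 + of_nat (index_pos a) else 0)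
      = capelli_rho.bordered a b" for a b :: "'n option"
  proof -
    have "c < Some i \<longleftrightarrow> c \<in> insert None (Some ` {j. j < i})" for c and i :: 'n
      by (cases c) auto
    then have "{c. c < Some i} = insert None (Some ` {j. j < i})" for i :: 'n by blast
    then have pos: "index_pos (Some i) = Suc (index_pos i)" for i :: 'n
      by (simp add: index_pos_def card_image)
    have pos0: "index_pos (None :: 'n option) = 0"
      by (simp add: index_pos_def)
    show ?thesis
      by (cases a; cases b)
        (simp_all add: capelli_rho.bordered_def capelli_rho.shifted_def pos pos0 pconst_add pconst_diff pconst_sum tens_mult
          tratio_tdel flip: pconst_mult)
  qed
  have euler: "pconst (tdel None None \<otimes> 1) + (\<Sum>i\<in>UNIV. pconst (tratio i \<otimes> 1) * pconst (tdel None (Some i) \<otimes> 1))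
      = (pconst (euler \<otimes> 1) :: ('n dprime, 'n ugl) tensor npoly)"
    by (simp add: euler_def sum_option tens_add_left tens_sum_left pconst_add pconst_sum tens_mult tratio_tdel
        flip: pconst_mult)
  show identity: "psubst (C_rho :: ('n dprime, 'n ugl) tensor npoly) (pvar + pconst R1)
      = (pconst (euler \<otimes> 1) - pvar) * ?C"
    by (simp only: psubst_C_rho entries capelli_rho.column_det_bordered map_psubst_capelli euler capelli_rho.shifted_def)
  have "comm R1 (euler \<otimes> 1) = (0 :: ('n dprime, 'n ugl) tensor)"
    by (simp add: euler_def tens_sum_left comm_sum_right comm_R1)
  then have "R1 * (euler \<otimes> 1) = (euler \<otimes> 1) * (R1 :: ('n dprime, 'n ugl) tensor)"
    by (simp add: comm_def)
  then have "peval (C_rho :: ('n dprime, 'n ugl) tensor npoly) (euler \<otimes> 1 + R1)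
      = peval (psubst C_rho (pvar + pconst R1)) (euler \<otimes> 1)"
    by (rule peval_psubst_shift[symmetric])
  also have "\<dots> = peval ((pconst (euler \<otimes> 1) - pvar) * ?C) (euler \<otimes> 1)"
    by (simp only: identity)
  also have "\<dots> = 0"
    by (rule peval_root_factor) (simp add: map.rep_eq when_def tens_mult)
  finally show "peval (C_rho :: ('n dprime, 'n ugl) tensor npoly) (euler \<otimes> 1 + R1) = 0" .
qed

end
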